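(* Let $v \in L^{\infty}(\mathbb{R})\cap L^{1}(\mathbb{R})$ be a bounded potential with $v \geq 0$ which is symmetric, $v(x)=v(-x)$, and whose support is $[-b,+b]$ for some $0<b<\infty$. Suppose that $v$ is strictly monotonically increasing on $[-b,-\varepsilon]$ for some $0<\varepsilon\leq b$ and that $\inf_{x\in[-\varepsilon,0]} v(x)>\gamma$ for some $\gamma>0$. Assume in addition that $b^2\|v\|_{\infty}<1/2$. Then there exists a constant $\beta>0$ such that $$\Gamma_v(L)\geq \frac{\beta}{L^4}$$ for all $L$ large enough, where $\Gamma_v(L)$ is the spectral gap of the Schrödinger operator $h_L=-\frac{\mathrm{d}^2}{\mathrm{d}x^2}+v$ on $L^2((-L/2,+L/2))$ with Neumann boundary conditions.
   Context: For $L>0$ let $I=(-L/2,+L/2)$. The operator $h_L=-\frac{\mathrm{d}^2}{\mathrm{d}x^2}+v$ is the self-adjoint operator on the Hilbert space $L^2(I)$ with Neumann boundary conditions at $x=\pm L/2$ (the derivative vanishes at both end points). It has purely discrete spectrum, with eigenvalues (counted with multiplicity) $0\leq\lambda_0(L)\leq\lambda_1(L)\leq\dots$; the lowest eigenvalue is non-degenerate. The spectral gap is $\Gamma_v(L):=\lambda_1(L)-\lambda_0(L)$. Here $\|v\|_\infty$ denotes the $L^\infty$-norm of $v$. "For all $L$ large enough" means: there is $L_0>0$ such that the assertion holds for all $L\geq L_0$; the constant $\beta$ does not depend on $L$. *)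

theory Defs
  imports "HOL-Probability.Probability" "HOL-Library.Function_Algebras"
begin

definition Linf_norm :: "(real \<Rightarrow> real) \<Rightarrow> ereal" where
  "Linf_norm v = esssup lebesgue (\<lambda>x. ereal \<bar>v x\<bar>)"

definition Linf :: "(real \<Rightarrow> real) set" where
  "Linf = {v. v \<in> borel_measurable lebesgue \<and> Linf_norm v < \<infinity>}"

text \<open>The support of (the class of) a measurable function: the complement of the largest open
  set on which it vanishes almost everywhere.\<close>

definition ess_support :: "(real \<Rightarrow> real) \<Rightarrow> real set" where
  "ess_support v = {x. \<forall>U. open U \<and> x \<in> U \<longrightarrow> \<not> (AE y in lebesgue. y \<in> U \<longrightarrow> v y = 0)}"

definition L2_on :: "real set \<Rightarrow> (real \<Rightarrow> complex) set" where
  "L2_on S = {f. f \<in> borel_measurable (lebesgue_on S) \<and>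
                 integrable (lebesgue_on S) (\<lambda>x. (norm (f x))\<^sup>2)}"

text \<open>Membership in the Neumann domain, i.e. in the set of all \<open>\<psi>\<close> in the Sobolev space
  \<open>H\<^sup>2(-L/2, L/2)\<close> with \<open>\<psi>'(-L/2) = \<psi>'(L/2) = 0\<close>, with first and second (weak) derivatives
  \<open>\<psi>'\<close> and \<open>\<psi>''\<close>: \<open>\<psi>\<close> is \<open>C\<^sup>1\<close> up to the boundary and \<open>\<psi>'\<close> is absolutely continuous with
  derivative \<open>\<psi>''\<close> in \<open>L\<^sup>2\<close>. An element of \<open>L\<^sup>2(-L/2, L/2)\<close> in the domain is represented by its
  unique representative that is continuous on the closed interval, extended by zero to the line.\<close>

definition neumann_H2 ::
  "real \<Rightarrow> (real \<Rightarrow> complex) \<Rightarrow> (real \<Rightarrow> complex) \<Rightarrow> (real \<Rightarrow> complex) \<Rightarrow> bool" where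
  "neumann_H2 L \<psi> \<psi>' \<psi>'' \<longleftrightarrow>
     (\<forall>x. x \<notin> {-L/2..L/2} \<longrightarrow> \<psi> x = 0) \<and>
     (\<forall>x\<in>{-L/2..L/2}. (\<psi> has_vector_derivative \<psi>' x) (at x within {-L/2..L/2})) \<and>
     \<psi>'' \<in> L2_on {-L/2<..<L/2} \<and>
     (\<forall>x\<in>{-L/2..L/2}. \<psi>' x = \<psi>' (-L/2) + (LINT t:{-L/2..x}|lebesgue. \<psi>'' t)) \<and>
     \<psi>' (-L/2) = 0 \<and> \<psi>' (L/2) = 0"

text \<open>The graph of \<open>h\<^sub>L = -d\<^sup>2/dx\<^sup>2 + v\<close>: \<open>\<psi>\<close> is in the domain and \<open>h\<^sub>L \<psi> = f\<close> in
  \<open>L\<^sup>2(-L/2, L/2)\<close>. For bounded \<open>v\<close>, the domain is that of the Neumann Laplacian.\<close>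

definition schroedinger_neumann ::
  "(real \<Rightarrow> real) \<Rightarrow> real \<Rightarrow> (real \<Rightarrow> complex) \<Rightarrow> (real \<Rightarrow> complex) \<Rightarrow> bool" where
  "schroedinger_neumann v L \<psi> f \<longleftrightarrow>
     (\<exists>\<psi>' \<psi>''. neumann_H2 L \<psi> \<psi>' \<psi>'' \<and>
        (AE x in lebesgue_on {-L/2<..<L/2}. - \<psi>'' x + of_real (v x) * \<psi> x = f x))"

definition eigenspace :: "(real \<Rightarrow> real) \<Rightarrow> real \<Rightarrow> real \<Rightarrow> (real \<Rightarrow> complex) set" where
  "eigenspace v L E = {\<psi>. schroedinger_neumann v L \<psi> (\<lambda>x. of_real E * \<psi> x)}"

interpretation cfun: vector_space "\<lambda>(c::complex) (f::real \<Rightarrow> complex) x. c * f x"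
  by unfold_locales (auto simp: fun_eq_iff algebra_simps)

text \<open>Complex dimension of the eigenspace; it is \<open>0\<close> iff \<open>E\<close> is not an eigenvalue
  (eigenspaces are finite-dimensional, so the value \<open>0\<close> of \<open>dim\<close> at infinite-dimensional
  spaces does not arise).\<close>

definition multiplicity_of :: "(real \<Rightarrow> real) \<Rightarrow> real \<Rightarrow> real \<Rightarrow> nat" where
  "multiplicity_of v L E = cfun.dim (eigenspace v L E)"

text \<open>The \<open>n\<close>-th eigenvalue (from \<open>n = 0\<close>), in increasing order and counted with multiplicity:
  the least \<open>E\<close> such that the eigenvalues in \<open>(-\<infinity>, E]\<close> have total multiplicity at least
  \<open>n + 1\<close>.\<close>

definition eigenvalue :: "(real \<Rightarrow> real) \<Rightarrow> real \<Rightarrow> nat \<Rightarrow> real" where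
  "eigenvalue v L n =
     Inf {E. \<exists>F. finite F \<and> F \<subseteq> {..E} \<and> n + 1 \<le> (\<Sum>\<mu>\<in>F. multiplicity_of v L \<mu>)}"

definition spectral_gap :: "(real \<Rightarrow> real) \<Rightarrow> real \<Rightarrow> real" where
  "spectral_gap v L = eigenvalue v L 1 - eigenvalue v L 0"

end

theory Submission
  imports Defs
begin

text \<open>The gap is bounded below through the ground state. Let \<open>\<psi> > 0\<close> be a Neumann eigenfunction with
energy \<open>E\<^sub>0\<close>, and \<open>\<eta>\<close> a real eigenfunction with another energy \<open>E\<close>. The Wronskian
\<open>W = \<psi> \<eta>' - \<psi>' \<eta>\<close> satisfies \<open>W' = (E\<^sub>0 - E) \<psi> \<eta>\<close> and vanishes at both ends, and the
quotient \<open>\<eta> / \<psi>\<close> has derivative \<open>W / \<psi>\<^sup>2\<close> and, by Rolle applied to \<open>W\<close>, a zero.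
Integrating twice over the interval of length \<open>L\<close> gives
\<open>\<bar>E - E\<^sub>0\<bar> \<ge> (min \<psi> / max \<psi>)\<^sup>2 / L\<^sup>2\<close> (\<open>distance_to_other_eigenvalues\<close>). The same identities
show that no eigenvalue lies below \<open>E\<^sub>0\<close> (\<open>no_eigenvalue_below\<close>) and that \<open>E\<^sub>0\<close> is simple
(\<open>same_energy_proportional\<close>). A bound of order \<open>L\<^sup>-\<^sup>4\<close> therefore follows once a positive
eigenfunction with \<open>min \<psi> / max \<psi>\<close> of order \<open>1 / L\<close> is found.

Such an eigenfunction is built by shooting. The potential is even and vanishes outside
\<open>[-b, b]\<close>, so an even eigenfunction on \<open>[0, L/2]\<close> consists of the solution on \<open>[0, b]\<close> with
initial data \<open>(1, 0)\<close> at the origin and of \<open>A cos (k (L/2 - x))\<close> on \<open>[b, L/2]\<close>, with energy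
\<open>E = k\<^sup>2\<close>. Here \<open>b\<^sup>2 \<parallel>v\<parallel> < 1/2\<close> enters: for energies between \<open>0\<close> and \<open>1 / (2 b\<^sup>2)\<close> the Picard
operator on \<open>[0, b]\<close> is a contraction with factor \<open>1/4\<close>, so the inner piece exists, depends
continuously on the energy and stays between \<open>2/3\<close> and \<open>4/3\<close> (\<open>even_ivp_bounds\<close>). The two
pieces fit together for some \<open>k\<close> with \<open>0 \<le> k (L/2 - b) < \<pi>/2\<close>, by the intermediate value
theorem (\<open>matching_energy\<close>), and there the cosine is positive too. The matching condition
prevents the cosine at \<open>b\<close> from being smaller than a multiple of \<open>1 / L\<close>
(\<open>matched_cos_bound\<close>), which bounds \<open>A\<close> and hence \<open>max \<psi>\<close> by a multiple of \<open>L\<close>.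

The eigenvalues of the theorem are infima over energies, counted with multiplicity, so the
set that defines the second one must be shown to be nonempty. Shooting with the initial data
\<open>(0, 1)\<close> gives an odd eigenfunction; its eigenspace is one-dimensional as well, so its energy
contributes to the count.\<close>

section \<open>Weak solutions of the stationary equation\<close>

text \<open>The equation \<open>f'' = q f\<close> on \<open>[a, c]\<close>, with \<open>f'\<close> given explicitly and the second derivative in
integrated form, because \<open>q\<close> is only measurable. Stating the integral on every subinterval
makes restriction, gluing and reflection immediate.\<close>

definition ode_on :: "(real \<Rightarrow> real) \<Rightarrow> real \<Rightarrow> real \<Rightarrow> (real \<Rightarrow> real) \<Rightarrow> (real \<Rightarrow> real) \<Rightarrow> bool" where
  "ode_on q a c f f' \<longleftrightarrow>
     (\<forall>x\<in>{a..c}. (f has_real_derivative f' x) (at x within {a..c})) \<and>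
     (\<forall>x y. a \<le> x \<and> x \<le> y \<and> y \<le> c \<longrightarrow> ((\<lambda>t. q t * f t) has_integral (f' y - f' x)) {x..y})"

lemma has_field_derivative_eq_on:
  fixes f g :: "'a::real_normed_field \<Rightarrow> 'a"
  assumes "x \<in> S" and "\<And>y. y \<in> S \<Longrightarrow> g y = f y"
    and "(f has_field_derivative D) (at x within S)"
  shows "(g has_field_derivative D) (at x within S)"
  using assms unfolding has_field_derivative_def by (rule has_derivative_transform)

lemma ode_on_deriv:
  "ode_on q a c f f' \<Longrightarrow> x \<in> {a..c} \<Longrightarrow> (f has_real_derivative f' x) (at x within {a..c})"
  by (simp add: ode_on_def)

lemma ode_on_integral:
  "ode_on q a c f f' \<Longrightarrow> a \<le> x \<Longrightarrow> x \<le> y \<Longrightarrow> y \<le> c \<Longrightarrow>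
     ((\<lambda>t. q t * f t) has_integral (f' y - f' x)) {x..y}"
  by (simp add: ode_on_def)

lemma ode_onI:
  assumes "\<And>x. x \<in> {a..c} \<Longrightarrow> (f has_real_derivative f' x) (at x within {a..c})"
    and int: "\<And>x. x \<in> {a..c} \<Longrightarrow> ((\<lambda>t. q t * f t) has_integral (f' x - f' a)) {a..x}"
  shows "ode_on q a c f f'"
  unfolding ode_on_def
proof (intro conjI ballI allI impI)
  fix x y assume xy: "a \<le> x \<and> x \<le> y \<and> y \<le> c"
  let ?h = "\<lambda>t. q t * f t"
  have ix: "(?h has_integral (f' x - f' a)) {a..x}" and iy: "(?h has_integral (f' y - f' a)) {a..y}"
    using int xy by auto
  have "?h integrable_on {x..y}"
    by (rule integrable_subinterval_real[of _ a y]) (use iy xy in \<open>auto intro: has_integral_integrable\<close>)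
  then obtain j where j: "(?h has_integral j) {x..y}" by blast
  have "(?h has_integral (f' x - f' a + j)) {a..y}"
    by (rule has_integral_combine[OF _ _ ix j]) (use xy in auto)
  then have "f' x - f' a + j = f' y - f' a" using iy has_integral_unique by blast
  then have "j = f' y - f' x" by simp
  then show "(?h has_integral (f' y - f' x)) {x..y}" using j by simp
qed (use assms in auto)

lemma ode_on_continuous: "ode_on q a c f f' \<Longrightarrow> continuous_on {a..c} f"
  by (meson DERIV_continuous continuous_on_eq_continuous_within ode_on_deriv)

lemma ode_on_continuous_deriv:
  assumes "ode_on q a c f f'"
  shows "continuous_on {a..c} f'"
proof (cases "a \<le> c")
  case True
  let ?h = "\<lambda>t. q t * f t"
  have "continuous_on {a..c} (\<lambda>x. f' a + integral {a..x} ?h)"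
    by (intro continuous_intros indefinite_integral_continuous_1)
      (use ode_on_integral[OF assms, of a c] True in \<open>auto intro: has_integral_integrable\<close>)
  moreover have "f' a + integral {a..x} ?h = f' x" if "x \<in> {a..c}" for x
    using ode_on_integral[OF assms, of a x] that by (simp add: integral_unique)
  ultimately show ?thesis by (metis (no_types, lifting) continuous_on_eq)
qed auto

lemma ode_on_subset:
  assumes "ode_on q a c f f'" "a \<le> a'" "c' \<le> c"
  shows "ode_on q a' c' f f'"
proof -
  have "{a'..c'} \<subseteq> {a..c}" using assms by auto
  then show ?thesis using assms unfolding ode_on_def
    by (meson DERIV_subset order_trans subsetD)
qed

lemma ode_on_cmult:
  assumes "ode_on q a c f f'"
  shows "ode_on q a c (\<lambda>x. k * f x) (\<lambda>x. k * f' x)"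
  unfolding ode_on_def
proof (intro conjI ballI allI impI)
  fix x assume "x \<in> {a..c}"
  then show "((\<lambda>x. k * f x) has_real_derivative k * f' x) (at x within {a..c})"
    by (intro DERIV_cmult ode_on_deriv[OF assms])
next
  fix x y assume "a \<le> x \<and> x \<le> y \<and> y \<le> c"
  then have "((\<lambda>t. k * (q t * f t)) has_integral k * (f' y - f' x)) {x..y}"
    by (intro has_integral_mult_right ode_on_integral[OF assms]) auto
  then show "((\<lambda>t. q t * (k * f t)) has_integral (k * f' y - k * f' x)) {x..y}"
    by (simp add: algebra_simps)
qed

lemma ode_on_reflect:
  assumes "ode_on q a c f f'" and even: "\<And>x. q (- x) = q x"
  shows "ode_on q (- c) (- a) (\<lambda>x. f (- x)) (\<lambda>x. - f' (- x))"
  unfolding ode_on_def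
proof (intro conjI ballI allI impI)
  fix x assume x: "x \<in> {- c..- a}"
  have img: "uminus ` {- c..- a} = {a..c}" by simp
  have "((f \<circ> uminus) has_real_derivative f' (- x) * (- 1)) (at x within {- c..- a})"
    by (rule DERIV_image_chain)
      (use x ode_on_deriv[OF assms(1), of "- x"] in \<open>auto simp: img intro!: derivative_eq_intros\<close>)
  then show "((\<lambda>x. f (- x)) has_real_derivative - f' (- x)) (at x within {- c..- a})"
    by (simp add: o_def)
next
  fix x y assume "- c \<le> x \<and> x \<le> y \<and> y \<le> - a"
  then have "((\<lambda>t. q t * f t) has_integral (f' (- x) - f' (- y))) {- y..- x}"
    by (intro ode_on_integral[OF assms(1)]) auto
  then have "((\<lambda>t. q (- t) * f (- t)) has_integral (f' (- x) - f' (- y))) {x..y}"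
    using has_integral_reflect_real[of "\<lambda>t. q t * f t" _ "- x" "- y"] by simp
  then show "((\<lambda>t. q t * f (- t)) has_integral (- f' (- y) - - f' (- x))) {x..y}"
    by (simp add: even)
qed

text \<open>Value and slope agree at \<open>m\<close>, which is all that a second-order equation in integrated form
requires of two pieces.\<close>

lemma ode_on_glue:
  assumes f: "ode_on q a m f f'" and g: "ode_on q m c g g'"
    and m: "a \<le> m" "m \<le> c" and eq: "f m = g m" "f' m = g' m"
  shows "ode_on q a c (\<lambda>x. if x \<le> m then f x else g x) (\<lambda>x. if x \<le> m then f' x else g' x)"
    (is "ode_on q a c ?u ?u'")
proof (rule ode_onI)
  fix x assume x: "x \<in> {a..c}"
  have ac: "{a..c} = {a..m} \<union> {m..c}" using m by auto
  have L: "(?u has_real_derivative ?u' x) (at x within {a..m})"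
  proof (cases "x \<le> m")
    case True
    then show ?thesis using x by (auto intro: has_field_derivative_eq_on[OF _ _ ode_on_deriv[OF f]])
  next
    case False
    then have "x \<notin> closure {a..m}" by simp
    then show ?thesis by (simp add: has_field_derivative_iff not_in_closure_trivial_limitI tendsto_bot trivial_limit_def)
  qed
  have R: "(?u has_real_derivative ?u' x) (at x within {m..c})"
  proof (cases "m \<le> x")
    case True
    have "(g has_real_derivative g' x) (at x within {m..c})" using True x by (intro ode_on_deriv[OF g]) auto
    moreover have "?u y = g y" if "y \<in> {m..c}" for y using that eq by (cases "y = m") auto
    moreover have "?u' x = g' x" using True eq by (cases "x = m") auto
    ultimately show ?thesis using x True by (auto intro: has_field_derivative_eq_on)
  next
    case False
    then have "x \<notin> closure {m..c}" by simp
    then show ?thesis by (simp add: has_field_derivative_iff not_in_closure_trivial_limitI tendsto_bot trivial_limit_def)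
  qed
  show "(?u has_real_derivative ?u' x) (at x within {a..c})"
    using L R unfolding ac has_field_derivative_iff by (rule Lim_Un)
next
  fix x assume x: "x \<in> {a..c}"
  have left: "((\<lambda>t. q t * ?u t) has_integral (f' y - f' a)) {a..y}" if "y \<in> {a..m}" for y
    by (rule has_integral_eq[OF _ ode_on_integral[OF f]]) (use that in auto)
  show "((\<lambda>t. q t * ?u t) has_integral (?u' x - ?u' a)) {a..x}"
  proof (cases "x \<le> m")
    case True
    then show ?thesis using left x m by auto
  next
    case False
    have "((\<lambda>t. q t * ?u t) has_integral (g' x - g' m)) {m..x}"
      by (rule has_integral_eq[OF _ ode_on_integral[OF g]]) (use x False eq in auto)
    then have "((\<lambda>t. q t * ?u t) has_integral (f' m - f' a + (g' x - g' m))) {a..x}"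
      using left[of m] m False by (intro has_integral_combine[of a m x]) auto
    then show ?thesis using False m eq by simp
  qed
qed

text \<open>Although \<open>f'\<close> and \<open>g'\<close> are differentiable only almost everywhere, the Wronskian is
differentiable at every point. Freeze the outer factors at \<open>x\<close>: the increment of
\<open>f x * g' - g x * f'\<close> is the integral of a function in which \<open>v\<close> is multiplied by
\<open>f x * g t - g x * f t\<close>. This factor vanishes at \<open>t = x\<close> and \<open>v\<close> is bounded, so the integrand is
continuous at \<open>x\<close>, and the fundamental theorem applies at that point.\<close>

lemma wronskian_deriv:
  assumes bd: "\<And>t. t \<in> {a..c} \<Longrightarrow> \<bar>v t\<bar> \<le> R"
    and f: "ode_on (\<lambda>t. v t - E) a c f f'" and g: "ode_on (\<lambda>t. v t - F) a c g g'"
    and x: "x \<in> {a..c}"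
  shows "((\<lambda>x. f x * g' x - f' x * g x) has_real_derivative (E - F) * f x * g x) (at x within {a..c})"
proof -
  have R: "0 \<le> R" using bd[OF x] by linarith
  define k where "k = (\<lambda>t. f x * ((v t - F) * g t) - g x * ((v t - E) * f t))"
  have cont: "continuous (at x within {a..c}) f" "continuous (at x within {a..c}) g"
    "continuous (at x within {a..c}) f'" "continuous (at x within {a..c}) g'"
    using x ode_on_continuous[OF f] ode_on_continuous[OF g]
      ode_on_continuous_deriv[OF f] ode_on_continuous_deriv[OF g]
    by (auto simp: continuous_on_eq_continuous_within)
  have k_int: "(k has_integral (f x * (g' y - g' a) - g x * (f' y - f' a))) {a..y}" if "y \<in> {a..c}" for y
    unfolding k_def using that
    by (intro has_integral_diff has_integral_mult_right ode_on_integral[OF f] ode_on_integral[OF g]) auto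
  have k_eq: "k t = v t * (f x * g t - g x * f t) + (E * g x * f t - F * f x * g t)" for t
    by (simp add: k_def algebra_simps)
  have "((\<lambda>t. v t * (f x * g t - g x * f t)) \<longlongrightarrow> 0) (at x within {a..c})"
  proof (rule Lim_null_comparison)
    show "eventually (\<lambda>t. norm (v t * (f x * g t - g x * f t)) \<le> R * \<bar>f x * g t - g x * f t\<bar>) (at x within {a..c})"
      unfolding eventually_at_filter using bd by (auto intro!: always_eventually mult_right_mono simp: abs_mult)
    have "((\<lambda>t. R * \<bar>f x * g t - g x * f t\<bar>) \<longlongrightarrow> R * \<bar>f x * g x - g x * f x\<bar>) (at x within {a..c})"
      using cont by (intro tendsto_intros) (auto simp: continuous_within)
    then show "((\<lambda>t. R * \<bar>f x * g t - g x * f t\<bar>) \<longlongrightarrow> 0) (at x within {a..c})" by simp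
  qed
  moreover have "((\<lambda>t. E * g x * f t - F * f x * g t) \<longlongrightarrow> E * g x * f x - F * f x * g x) (at x within {a..c})"
    using cont by (intro tendsto_intros) (auto simp: continuous_within)
  ultimately have "(k \<longlongrightarrow> 0 + (E * g x * f x - F * f x * g x)) (at x within {a..c})"
    unfolding k_eq by (rule tendsto_add)
  then have kc: "continuous (at x within {a..c}) k" unfolding continuous_within by (simp add: k_eq)
  have kx: "k x = (E - F) * f x * g x" by (simp add: k_eq algebra_simps)
  have "((\<lambda>u. integral {a..u} k) has_vector_derivative k x) (at x within {a..c})"
    using integral_has_vector_derivative_continuous_at[of k a c x "{}"] kc x k_int[of c]
    by (auto intro: has_integral_integrable)
  then have "((\<lambda>u. integral {a..u} k) has_real_derivative k x) (at x within {a..c})"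
    by (simp add: has_real_derivative_iff_has_vector_derivative)
  then have D1: "((\<lambda>y. f x * (g' y - g' a) - g x * (f' y - f' a)) has_real_derivative k x) (at x within {a..c})"
    by (rule has_field_derivative_eq_on[OF x, rotated]) (use k_int in \<open>auto intro!: integral_unique[symmetric]\<close>)
  \<comment> \<open>A product of a function that is differentiable and zero at \<open>x\<close> with a function that is merely
    continuous at \<open>x\<close>; the usual product rule does not apply.\<close>
  have D: "((\<lambda>y. (f y - f x) * g' y) has_real_derivative f' x * g' x) (at x within {a..c})"
    if "(f has_real_derivative f' x) (at x within {a..c})" "continuous (at x within {a..c}) g'" for f f' g' :: "real \<Rightarrow> real"
  proof -
    have "((\<lambda>y. ((f y - f x) / (y - x)) * g' y) \<longlongrightarrow> f' x * g' x) (at x within {a..c})"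
      using that by (intro tendsto_mult) (auto simp: has_field_derivative_iff continuous_within)
    then show ?thesis by (simp add: has_field_derivative_iff)
  qed
  have "((\<lambda>y. (f x * (g' y - g' a) - g x * (f' y - f' a)) + ((f y - f x) * g' y - (g y - g x) * f' y)
            + (f x * g' a - g x * f' a))
     has_real_derivative k x + (f' x * g' x - g' x * f' x) + 0) (at x within {a..c})"
    using x cont by (intro DERIV_add DERIV_diff DERIV_const D1 D ode_on_deriv[OF f] ode_on_deriv[OF g])
  moreover have "(\<lambda>y. (f x * (g' y - g' a) - g x * (f' y - f' a)) + ((f y - f x) * g' y - (g y - g x) * f' y)
            + (f x * g' a - g x * f' a)) = (\<lambda>y. f y * g' y - f' y * g y)"
    by (simp add: fun_eq_iff algebra_simps)
  ultimately show ?thesis by (simp add: kx algebra_simps)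
qed

section \<open>The initial value problem across the barrier\<close>

text \<open>Here \<open>h\<close> plays the part of the second derivative of \<open>z\<close>. The factor \<open>1/2\<close> from the double
integration turns \<open>b\<^sup>2 R \<le> 1/2\<close> into the contraction factor \<open>1/4\<close>.\<close>

lemma twice_integrated_bound:
  fixes b H :: real
  assumes deriv: "\<And>x. x \<in> {0..b} \<Longrightarrow> (z has_real_derivative z' x) (at x within {0..b})"
    and z0: "z 0 = 0"
    and int: "\<And>x. x \<in> {0..b} \<Longrightarrow> (h has_integral z' x) {0..x}"
    and bd: "\<And>x. x \<in> {0..b} \<Longrightarrow> \<bar>h x\<bar> \<le> H"
    and x: "x \<in> {0..b}"
  shows "\<bar>z' x\<bar> \<le> H * b" and "\<bar>z x\<bar> \<le> H * b\<^sup>2 / 2"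
proof -
  have H: "0 \<le> H" using bd[OF x] by linarith
  have *: "\<bar>z' y\<bar> \<le> H * y" if "y \<in> {0..b}" for y
    using has_integral_bound_real[OF H finite.emptyI int[OF that]] bd that by (auto simp: content_real)
  have "H * x \<le> H * b" using x H by (intro mult_left_mono) auto
  then show "\<bar>z' x\<bar> \<le> H * b" using *[OF x] by linarith
  have zi: "(z' has_integral z x) {0..x}"
  proof -
    have "(z' has_integral (z x - z 0)) {0..x}"
      using x deriv
      by (intro fundamental_theorem_of_calculus)
        (auto simp: has_real_derivative_iff_has_vector_derivative[symmetric] intro!: DERIV_subset[OF deriv])
    then show ?thesis using z0 by simp
  qed
  have hi: "((\<lambda>y. H * y) has_integral H * (x\<^sup>2 / 2)) {0..x}"
    using has_integral_mult_right[OF ident_has_integral[of 0 x], of H] x by simp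
  have "z x \<le> H * (x\<^sup>2 / 2)"
    by (rule has_integral_le[OF zi hi]) (use * x in \<open>force simp: abs_le_iff\<close>)
  moreover have "- z x \<le> H * (x\<^sup>2 / 2)"
    by (rule has_integral_le[OF has_integral_neg[OF zi] hi]) (use * x in \<open>force simp: abs_le_iff\<close>)
  moreover have "H * (x\<^sup>2 / 2) \<le> H * (b\<^sup>2 / 2)" using x H by (intro mult_left_mono divide_right_mono power_mono) auto
  ultimately show "\<bar>z x\<bar> \<le> H * b\<^sup>2 / 2" by (simp add: abs_le_iff)
qed

lemma abs_attains_max_on_interval:
  fixes f :: "real \<Rightarrow> real"
  assumes "a \<le> c" and "continuous_on {a..c} f"
  shows "\<exists>x0\<in>{a..c}. \<forall>x\<in>{a..c}. \<bar>f x\<bar> \<le> \<bar>f x0\<bar>"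
  using assms by (intro continuous_attains_sup continuous_on_rabs) auto

text \<open>The difference of the solutions satisfies an equation with source \<open>(q - r) w\<close>. The smallness
of \<open>b\<^sup>2 R\<close> allows the term \<open>q (y - w)\<close> to be absorbed into the left-hand side, so no exponential
factor appears. With \<open>r = 0\<close> this compares a solution with an affine function; with
\<open>q\<close> and \<open>r\<close> belonging to two energies it gives Lipschitz dependence on the energy.\<close>

lemma ivp_compare:
  fixes b :: real
  assumes b: "0 < b" and small: "b\<^sup>2 * R \<le> 1/2"
    and q: "\<And>t. t \<in> {0..b} \<Longrightarrow> \<bar>q t\<bar> \<le> R"
    and qr: "\<And>t. t \<in> {0..b} \<Longrightarrow> \<bar>q t - r t\<bar> \<le> \<delta>"
    and y: "ode_on q 0 b y y'" and w: "ode_on r 0 b w w'"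
    and init: "y 0 = w 0" "y' 0 = w' 0"
    and wB: "\<And>t. t \<in> {0..b} \<Longrightarrow> \<bar>w t\<bar> \<le> B"
    and x: "x \<in> {0..b}"
  shows "\<bar>y x - w x\<bar> \<le> 2/3 * (\<delta> * B * b\<^sup>2)" and "\<bar>y' x - w' x\<bar> \<le> 4/3 * (\<delta> * B * b)"
proof -
  have "continuous_on {0..b} (\<lambda>x. y x - w x)"
    by (intro continuous_intros ode_on_continuous[OF y] ode_on_continuous[OF w])
  then obtain x0 where x0: "x0 \<in> {0..b}" and max: "\<And>t. t \<in> {0..b} \<Longrightarrow> \<bar>y t - w t\<bar> \<le> \<bar>y x0 - w x0\<bar>"
    using abs_attains_max_on_interval[OF less_imp_le[OF b]] by blast
  define N where "N = \<bar>y x0 - w x0\<bar>"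
  have R: "0 \<le> R" and d: "0 \<le> \<delta>" and B: "0 \<le> B" using q[OF x] qr[OF x] wB[OF x] by linarith+
  define h where "h = (\<lambda>t. q t * y t - r t * w t)"
  have bd: "\<bar>h t\<bar> \<le> R * N + \<delta> * B" if "t \<in> {0..b}" for t
  proof -
    have "h t = q t * (y t - w t) + (q t - r t) * w t" by (simp add: h_def algebra_simps)
    also have "\<bar>\<dots>\<bar> \<le> \<bar>q t\<bar> * \<bar>y t - w t\<bar> + \<bar>q t - r t\<bar> * \<bar>w t\<bar>"
      by (metis abs_mult abs_triangle_ineq)
    also have "\<dots> \<le> R * N + \<delta> * B"
      unfolding N_def using that R d by (intro add_mono mult_mono q max qr wB) auto
    finally show ?thesis .
  qed
  have deriv: "((\<lambda>x. y x - w x) has_real_derivative (y' x - w' x)) (at x within {0..b})" if "x \<in> {0..b}" for x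
    by (intro DERIV_diff ode_on_deriv[OF y] ode_on_deriv[OF w] that)
  have int: "(h has_integral (y' x - w' x)) {0..x}" if "x \<in> {0..b}" for x
  proof -
    have "(h has_integral (y' x - y' 0 - (w' x - w' 0))) {0..x}"
      unfolding h_def using that by (intro has_integral_diff ode_on_integral[OF y] ode_on_integral[OF w]) auto
    then show ?thesis using init by simp
  qed
  have *: "\<bar>y' x - w' x\<bar> \<le> (R * N + \<delta> * B) * b" "\<bar>y x - w x\<bar> \<le> (R * N + \<delta> * B) * b\<^sup>2 / 2" if "x \<in> {0..b}" for x
    using twice_integrated_bound[of b "\<lambda>x. y x - w x" "\<lambda>x. y' x - w' x" h "R * N + \<delta> * B" x] deriv int bd init that
    by auto
  have RN: "b\<^sup>2 * R * N \<le> 1/2 * N" by (rule mult_right_mono[OF small]) (simp add: N_def)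
  have "N \<le> (R * N + \<delta> * B) * b\<^sup>2 / 2" using *(2)[OF x0] by (simp add: N_def)
  also have "(R * N + \<delta> * B) * b\<^sup>2 / 2 = (b\<^sup>2 * R * N) / 2 + (\<delta> * B * b\<^sup>2) / 2"
    by (simp add: distrib_right add_divide_distrib)
  finally have N: "N \<le> 2/3 * (\<delta> * B * b\<^sup>2)" using RN by linarith
  then show "\<bar>y x - w x\<bar> \<le> 2/3 * (\<delta> * B * b\<^sup>2)" using max[OF x] unfolding N_def by linarith
  have "R * N * b * b = b\<^sup>2 * R * N" by (simp add: power2_eq_square)
  also have "\<dots> \<le> 1/3 * (\<delta> * B * b\<^sup>2)" using RN N by linarith
  also have "\<dots> = 1/3 * (\<delta> * B * b) * b" by (simp add: power2_eq_square)
  finally have "R * N * b \<le> 1/3 * (\<delta> * B * b)" using b by (rule mult_right_le_imp_le)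
  moreover have "\<bar>y' x - w' x\<bar> \<le> R * N * b + \<delta> * B * b" using *(1)[OF x] by (simp add: distrib_right)
  ultimately show "\<bar>y' x - w' x\<bar> \<le> 4/3 * (\<delta> * B * b)" by linarith
qed

lemma ivp_near_affine:
  fixes b :: real
  assumes b: "0 < b" and small: "b\<^sup>2 * R \<le> 1/2"
    and q: "\<And>t. t \<in> {0..b} \<Longrightarrow> \<bar>q t\<bar> \<le> R"
    and y: "ode_on q 0 b y y'" and init: "y 0 = p" "y' 0 = s"
    and P: "\<And>t. t \<in> {0..b} \<Longrightarrow> \<bar>p + s * t\<bar> \<le> P"
    and x: "x \<in> {0..b}"
  shows "\<bar>y x - (p + s * x)\<bar> \<le> P / 3" and "\<bar>y' x - s\<bar> \<le> 4/3 * (R * P * b)"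
proof -
  have w: "ode_on (\<lambda>_. 0) 0 b (\<lambda>x. p + s * x) (\<lambda>_. s)"
    by (auto simp: ode_on_def intro!: derivative_eq_intros)
  have qr: "\<bar>q t - 0\<bar> \<le> R" if "t \<in> {0..b}" for t using q[OF that] by simp
  have 0: "0 \<le> P" using P[OF x] by linarith
  note cmp = ivp_compare[OF b small q qr y w _ _ P x]
  have "\<bar>y x - (p + s * x)\<bar> \<le> 2/3 * (R * P * b\<^sup>2)" using cmp(1) init by simp
  also have "\<dots> \<le> P / 3" using mult_right_mono[OF small 0] by (simp add: field_simps)
  finally show "\<bar>y x - (p + s * x)\<bar> \<le> P / 3" .
  show "\<bar>y' x - s\<bar> \<le> 4/3 * (R * P * b)" using cmp(2) init by simp
qed

lemma bounded_times_continuous_integrable: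
  fixes q u :: "real \<Rightarrow> real"
  assumes q: "q \<in> borel_measurable lebesgue" and bd: "\<And>t. t \<in> {a..c} \<Longrightarrow> \<bar>q t\<bar> \<le> R"
    and u: "continuous_on {a..c} u"
  shows "(\<lambda>t. q t * u t) absolutely_integrable_on {a..c}"
proof -
  have "(\<lambda>x. (\<lambda>c d. c * d) (q x) (u x)) absolutely_integrable_on {a..c}"
  proof (rule absolutely_integrable_bounded_measurable_product[where h = "\<lambda>c d. c * d" and f = q and g = u])
    show "q \<in> borel_measurable (lebesgue_on {a..c})" using q by (simp add: measurable_restrict_space1)
    show "bounded (q ` {a..c})" unfolding bounded_iff by (intro exI[of _ R]) (use bd in auto)
    show "u absolutely_integrable_on {a..c}" using u by (rule absolutely_integrable_continuous_real)
    show "bilinear (\<lambda>c d :: real. c * d)" by (simp add: bilinear_conv_bounded_bilinear bounded_bilinear_mult)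
  qed (use assms in auto)
  then show ?thesis by simp
qed

text \<open>The Picard operator is \<open>G u x = p + s x + \<integral>\<^sub>0\<^sup>x D u\<close> with \<open>D u x = \<integral>\<^sub>0\<^sup>x q u\<close>. It is applied to bounded
continuous functions on the whole line, which form a complete metric space; clamping the
argument to \<open>[0, b]\<close> turns \<open>G u\<close> into such a function.\<close>

lemma ivp_exists:
  fixes b :: real
  assumes b: "0 < b" and small: "b\<^sup>2 * R \<le> 1/2"
    and qm: "q \<in> borel_measurable lebesgue" and q: "\<And>t. t \<in> {0..b} \<Longrightarrow> \<bar>q t\<bar> \<le> R"
  shows "\<exists>y y'. ode_on q 0 b y y' \<and> y 0 = p \<and> y' 0 = s"
proof -
  define D where "D = (\<lambda>u x. integral {0..x} (\<lambda>t. q t * u t))"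
  define G where "G = (\<lambda>u x. p + s * x + integral {0..x} (D u))"
  define cl where "cl = (\<lambda>x. max 0 (min b x))"
  have R: "0 \<le> R" using q[of 0] b by fastforce
  have cl: "cl x \<in> {0..b}" for x using b by (auto simp: cl_def)
  have cl_id: "cl x = x" if "x \<in> {0..b}" for x using that by (auto simp: cl_def)
  have Dint: "(\<lambda>t. q t * u t) integrable_on {0..x}" if "continuous_on {0..b} u" "x \<in> {0..b}" for u x
  proof -
    have "(\<lambda>t. q t * u t) absolutely_integrable_on {0..x}"
      by (rule bounded_times_continuous_integrable[OF qm, of _ _ R])
        (use q that in \<open>auto intro: continuous_on_subset\<close>)
    then show ?thesis by (rule absolutely_integrable_on_def[THEN iffD1, THEN conjunct1])
  qed
  have Dcont: "continuous_on {0..b} (D u)" if "continuous_on {0..b} u" for u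
    unfolding D_def using Dint[OF that, of b] b by (intro indefinite_integral_continuous_1) auto
  have Gderiv: "(G u has_real_derivative (s + D u x)) (at x within {0..b})"
    if "continuous_on {0..b} u" "x \<in> {0..b}" for u x
    unfolding G_def
    using integral_has_real_derivative[OF Dcont[OF that(1)] that(2)]
    by (auto intro!: derivative_eq_intros)
  have Gcont: "continuous_on {0..b} (G u)" if "continuous_on {0..b} u" for u
    using Gderiv[OF that] by (meson DERIV_continuous continuous_on_eq_continuous_within)
  have contr: "\<bar>G u x - G w x\<bar> \<le> d / 4"
    if u: "continuous_on {0..b} u" and w: "continuous_on {0..b} w" and x: "x \<in> {0..b}"
      and d: "\<And>t. t \<in> {0..b} \<Longrightarrow> \<bar>u t - w t\<bar> \<le> d" for u w x d
  proof -
    have 0: "0 \<le> d" using d[OF x] by linarith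
    have "\<bar>G u x - G w x\<bar> \<le> (R * d) * b\<^sup>2 / 2"
    proof (rule twice_integrated_bound(2)[where z = "\<lambda>x. G u x - G w x" and z' = "\<lambda>x. D u x - D w x"
          and h = "\<lambda>t. q t * u t - q t * w t"])
      fix y assume y: "y \<in> {0..b}"
      show "((\<lambda>x. G u x - G w x) has_real_derivative D u y - D w y) (at y within {0..b})"
        using DERIV_diff[OF Gderiv[OF u y] Gderiv[OF w y]] by simp
      show "((\<lambda>t. q t * u t - q t * w t) has_integral D u y - D w y) {0..y}"
        unfolding D_def by (intro has_integral_diff integrable_integral Dint u w y)
      show "\<bar>q y * u y - q y * w y\<bar> \<le> R * d"
        using mult_mono[OF q[OF y] d[OF y]] R by (simp add: abs_mult[symmetric] algebra_simps)
    qed (use x in \<open>auto simp: G_def\<close>)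
    also have "\<dots> \<le> d / 4" using mult_right_mono[OF small 0] by (simp add: field_simps)
    finally show ?thesis .
  qed
  define T :: "(real \<Rightarrow>\<^sub>C real) \<Rightarrow> (real \<Rightarrow>\<^sub>C real)" where "T = (\<lambda>u. Bcontfun (\<lambda>x. G u (cl x)))"
  have T: "T u x = G u (cl x)" for u x
  proof -
    have "(\<lambda>x. G u (cl x)) \<in> bcontfun"
    proof -
      have "compact (G u ` {0..b})" by (intro compact_continuous_image Gcont) auto
      then obtain B where B: "\<And>x. x \<in> {0..b} \<Longrightarrow> norm (G u x) \<le> B"
        using compact_imp_bounded[of "G u ` {0..b}"] unfolding bounded_iff by blast
      have "continuous_on UNIV (\<lambda>x. G u (cl x))"
      proof (rule continuous_on_compose2[OF Gcont])
        show "continuous_on {0..b} (apply_bcontfun u)" by simp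
        show "continuous_on UNIV cl" unfolding cl_def by (intro continuous_intros)
        show "cl ` UNIV \<subseteq> {0..b}" using cl by blast
      qed
      then show ?thesis by (rule bcontfun_normI) (use B cl in auto)
    qed
    then show ?thesis by (simp add: T_def Bcontfun_inverse)
  qed
  have "\<exists>!u. T u = u"
  proof (rule banach_fix_type[where c = "1/4"])
    show "\<forall>u w. dist (T u) (T w) \<le> 1/4 * dist u w"
    proof (intro allI)
      fix u w :: "real \<Rightarrow>\<^sub>C real"
      show "dist (T u) (T w) \<le> 1/4 * dist u w"
      proof -
        have "dist (T u) (T w) \<le> dist u w / 4"
        proof (rule dist_bound)
          fix x
          show "dist (T u x) (T w x) \<le> dist u w / 4"
            unfolding T dist_real_def
          proof (rule contr)
            show "\<bar>u t - w t\<bar> \<le> dist u w" for t using dist_bounded[of u t w] by (simp add: dist_real_def)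
          qed (use cl in simp_all)
        qed
        then show ?thesis by simp
      qed
    qed
  qed simp_all
  then obtain u where u: "T u = u" by auto
  have uc: "continuous_on {0..b} (apply_bcontfun u)" by simp
  have ueq: "u x = G u x" if "x \<in> {0..b}" for x using T[of u x] u cl_id[OF that] by simp
  have "ode_on q 0 b u (\<lambda>x. s + D u x)"
  proof (rule ode_onI)
    fix x assume x: "x \<in> {0..b}"
    show "(u has_real_derivative s + D u x) (at x within {0..b})"
      using has_field_derivative_eq_on[OF x ueq Gderiv[OF uc x]] .
    show "((\<lambda>t. q t * u t) has_integral (s + D u x - (s + D u 0))) {0..x}"
      using integrable_integral[OF Dint[OF uc x]] by (simp add: D_def)
  qed
  moreover have "u 0 = p" using ueq[of 0] b by (simp add: G_def)
  moreover have "s + D u 0 = s" by (simp add: D_def)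
  ultimately show ?thesis by blast
qed

section \<open>Eigenvalues in the presence of a positive eigenfunction\<close>

lemma quotient_deriv_wronskian:
  assumes \<psi>: "ode_on p a c \<psi> \<psi>'" and \<eta>: "ode_on q a c \<eta> \<eta>'"
    and "x \<in> {a..c}" and "\<psi> x \<noteq> 0"
  shows "((\<lambda>x. \<eta> x / \<psi> x) has_real_derivative (\<psi> x * \<eta>' x - \<psi>' x * \<eta> x) / (\<psi> x)\<^sup>2) (at x within {a..c})"
  using DERIV_divide[OF ode_on_deriv[OF \<eta>] ode_on_deriv[OF \<psi>], of x] assms
  by (simp add: power2_eq_square mult.commute)

text \<open>For equal energies the Wronskian is constant, hence zero, and so the quotient of the two
solutions is constant.\<close>

lemma same_energy_proportional:
  assumes ac: "a \<le> c" and bd: "\<And>t. t \<in> {a..c} \<Longrightarrow> \<bar>v t\<bar> \<le> R"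
    and \<psi>: "ode_on (\<lambda>t. v t - E) a c \<psi> \<psi>'" and \<eta>: "ode_on (\<lambda>t. v t - E) a c \<eta> \<eta>'"
    and bc: "\<psi> c * \<eta>' c = \<psi>' c * \<eta> c"
    and pos: "\<And>t. t \<in> {a..c} \<Longrightarrow> 0 < \<psi> t"
    and x: "x \<in> {a..c}"
  shows "\<eta> x = \<eta> c / \<psi> c * \<psi> x"
proof -
  have "((\<lambda>x. \<psi> x * \<eta>' x - \<psi>' x * \<eta> x) has_real_derivative 0) (at y within {a..c})" if "y \<in> {a..c}" for y
    using wronskian_deriv[OF bd \<psi> \<eta> that] by simp
  then obtain k where k: "\<And>y. y \<in> {a..c} \<Longrightarrow> \<psi> y * \<eta>' y - \<psi>' y * \<eta> y = k"
    using has_field_derivative_zero_constant[of "{a..c}" "\<lambda>x. \<psi> x * \<eta>' x - \<psi>' x * \<eta> x"] by auto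
  have "k = 0" using k[of c] ac bc by simp
  then have "((\<lambda>x. \<eta> x / \<psi> x) has_real_derivative 0) (at y within {a..c})" if "y \<in> {a..c}" for y
    using quotient_deriv_wronskian[OF \<psi> \<eta> that] pos[OF that] k[OF that] by simp
  then obtain d where "\<And>y. y \<in> {a..c} \<Longrightarrow> \<eta> y / \<psi> y = d"
    using has_field_derivative_zero_constant[of "{a..c}" "\<lambda>x. \<eta> x / \<psi> x"] by auto
  then have "\<eta> x / \<psi> x = \<eta> c / \<psi> c" using x ac by simp
  then show ?thesis using pos[OF x] by (simp add: field_simps)
qed

text \<open>The function \<open>W \<eta> / \<psi>\<close> vanishes at both ends, while its derivative
\<open>(E0 - E) \<eta>\<^sup>2 + (W / \<psi>)\<^sup>2\<close> is nonnegative and continuous; so the derivative is zero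
throughout.\<close>

lemma no_eigenvalue_below:
  assumes ac: "a < c" and bd: "\<And>t. t \<in> {a..c} \<Longrightarrow> \<bar>v t\<bar> \<le> R"
    and \<psi>: "ode_on (\<lambda>t. v t - E0) a c \<psi> \<psi>'" and \<eta>: "ode_on (\<lambda>t. v t - E) a c \<eta> \<eta>'"
    and bc: "\<psi>' a = 0" "\<psi>' c = 0" "\<eta>' a = 0" "\<eta>' c = 0"
    and pos: "\<And>t. t \<in> {a..c} \<Longrightarrow> 0 < \<psi> t"
    and less: "E < E0" and x: "x \<in> {a..c}"
  shows "\<eta> x = 0"
proof -
  define W where "W = (\<lambda>x. \<psi> x * \<eta>' x - \<psi>' x * \<eta> x)"
  define D where "D = (\<lambda>x. (E0 - E) * (\<eta> x)\<^sup>2 + (W x / \<psi> x)\<^sup>2)"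
  have nz: "\<psi> y \<noteq> 0" if "y \<in> {a..c}" for y using pos[OF that] by simp
  have dD: "((\<lambda>x. W x * (\<eta> x / \<psi> x)) has_real_derivative D y) (at y within {a..c})" if y: "y \<in> {a..c}" for y
  proof -
    have "((\<lambda>x. W x * (\<eta> x / \<psi> x)) has_real_derivative
        ((E0 - E) * \<psi> y * \<eta> y) * (\<eta> y / \<psi> y) + (W y / (\<psi> y)\<^sup>2) * W y) (at y within {a..c})"
      using wronskian_deriv[OF bd \<psi> \<eta> y] quotient_deriv_wronskian[OF \<psi> \<eta> y nz[OF y]]
      unfolding W_def by (intro DERIV_mult)
    moreover have "((E0 - E) * \<psi> y * \<eta> y) * (\<eta> y / \<psi> y) + (W y / (\<psi> y)\<^sup>2) * W y = D y"
      using nz[OF y] by (simp add: D_def power2_eq_square)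
    ultimately show ?thesis by simp
  qed
  have "(D has_integral (W c * (\<eta> c / \<psi> c) - W a * (\<eta> a / \<psi> a))) {a..c}"
    using ac dD by (intro fundamental_theorem_of_calculus)
      (auto simp: has_real_derivative_iff_has_vector_derivative[symmetric])
  then have D0: "(D has_integral 0) (cbox a c)" by (simp add: W_def bc)
  have Dcont: "continuous_on (cbox a c) D"
    unfolding D_def W_def box_real
    by (intro continuous_on_add continuous_on_mult continuous_on_power continuous_on_divide
        continuous_on_diff continuous_on_const ode_on_continuous[OF \<psi>] ode_on_continuous[OF \<eta>]
        ode_on_continuous_deriv[OF \<psi>] ode_on_continuous_deriv[OF \<eta>]) (use nz in auto)
  have Dnn: "0 \<le> D y" for y using less by (simp add: D_def)
  have "D x = 0"
    by (rule has_integral_0_cbox_imp_0[OF Dcont Dnn D0]) (use ac x in \<open>simp_all add: box_real\<close>)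
  then have "(E0 - E) * (\<eta> x)\<^sup>2 = 0"
    using less unfolding D_def by (smt (verit) mult_nonneg_nonneg zero_le_power2)
  then show ?thesis using less by simp
qed

text \<open>Put \<open>w = \<eta> / \<psi>\<close>. A zero of \<open>W'\<close>, which exists by Rolle, is a zero of \<open>w\<close>. Then
\<open>\<bar>W\<bar> \<le> (c - a) \<bar>E - E0\<bar> M\<^sup>2 sup \<bar>w\<bar>\<close> and \<open>sup \<bar>w\<bar> \<le> (c - a) sup \<bar>W\<bar> / m\<^sup>2\<close>, and \<open>sup \<bar>w\<bar>\<close> cancels.\<close>

lemma distance_to_other_eigenvalues:
  assumes ac: "a < c" and bd: "\<And>t. t \<in> {a..c} \<Longrightarrow> \<bar>v t\<bar> \<le> R"
    and \<psi>: "ode_on (\<lambda>t. v t - E0) a c \<psi> \<psi>'" and \<eta>: "ode_on (\<lambda>t. v t - E) a c \<eta> \<eta>'"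
    and bc: "\<psi>' a = 0" "\<psi>' c = 0" "\<eta>' a = 0" "\<eta>' c = 0"
    and m: "0 < m" and bounds: "\<And>t. t \<in> {a..c} \<Longrightarrow> m \<le> \<psi> t \<and> \<psi> t \<le> M"
    and ne: "E \<noteq> E0" and y: "y \<in> {a..c}" "\<eta> y \<noteq> 0"
  shows "(m / M)\<^sup>2 / (c - a)\<^sup>2 \<le> \<bar>E - E0\<bar>"
proof -
  define W where "W = (\<lambda>x. \<psi> x * \<eta>' x - \<psi>' x * \<eta> x)"
  define w where "w = (\<lambda>x. \<eta> x / \<psi> x)"
  have pos: "0 < \<psi> t" if "t \<in> {a..c}" for t using bounds[OF that] m by linarith
  have M: "0 < M" using bounds[OF y(1)] m by linarith
  have dW: "(W has_real_derivative (E0 - E) * \<psi> x * \<eta> x) (at x within {a..c})" if "x \<in> {a..c}" for x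
    unfolding W_def by (rule wronskian_deriv[OF bd \<psi> \<eta> that])
  have dw: "(w has_real_derivative W x / (\<psi> x)\<^sup>2) (at x within {a..c})" if "x \<in> {a..c}" for x
    unfolding w_def W_def using quotient_deriv_wronskian[OF \<psi> \<eta> that] pos[OF that] by simp
  have W0: "W a = 0" "W c = 0" by (simp_all add: W_def bc)
  have "\<exists>z>a. z < c \<and> (\<lambda>h. h * ((E0 - E) * \<psi> z * \<eta> z)) = (\<lambda>h. 0)"
  proof (rule Rolle_deriv[OF ac])
    show "continuous_on {a..c} W"
      using dW by (meson DERIV_continuous continuous_on_eq_continuous_within)
    fix x assume x: "a < x" "x < c"
    have "(W has_real_derivative (E0 - E) * \<psi> x * \<eta> x) (at x)"
      using dW[of x] x by (metis at_within_Icc_at atLeastAtMost_iff less_imp_le)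
    then show "(W has_derivative (\<lambda>h. h * ((E0 - E) * \<psi> x * \<eta> x))) (at x)"
      by (simp add: has_field_derivative_def mult.commute[of _ "_ * _"] mult_commute_abs)
  qed (simp add: W0)
  then obtain z where z: "z \<in> {a..c}" "(E0 - E) * \<psi> z * \<eta> z = 0"
    by (metis atLeastAtMost_iff less_imp_le mult_1)
  then have wz: "w z = 0" using ne pos[OF z(1)] by (simp add: w_def)
  have "continuous_on {a..c} w"
    using dw by (meson DERIV_continuous continuous_on_eq_continuous_within)
  then obtain x0 where x0: "x0 \<in> {a..c}" and max: "\<And>x. x \<in> {a..c} \<Longrightarrow> \<bar>w x\<bar> \<le> \<bar>w x0\<bar>"
    using abs_attains_max_on_interval[OF less_imp_le[OF ac]] by blast
  define N where "N = \<bar>w x0\<bar>"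
  have "0 < \<bar>w y\<bar>" using y pos[OF y(1)] by (simp add: w_def)
  then have N: "0 < N" using max[OF y(1)] by (simp add: N_def)
  define K where "K = \<bar>E - E0\<bar> * M\<^sup>2 * N"
  have K: "0 \<le> K" using N by (simp add: K_def)
  have W: "\<bar>W x\<bar> \<le> K * (c - a)" if x: "x \<in> {a..c}" for x
  proof -
    have "norm (W x - W a) \<le> K * norm (x - a)"
    proof (rule field_differentiable_bound[where S = "{a..c}", OF _ dW])
      fix t assume t: "t \<in> {a..c}"
      have "\<bar>(E0 - E) * \<psi> t * \<eta> t\<bar> = \<bar>E - E0\<bar> * ((\<psi> t)\<^sup>2 * \<bar>w t\<bar>)"
        using pos[OF t] by (simp add: w_def abs_mult power2_eq_square abs_minus_commute)
      also have "\<dots> \<le> \<bar>E - E0\<bar> * (M\<^sup>2 * N)"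
        using pos[OF t] bounds[OF t] max[OF t] unfolding N_def
        by (intro mult_left_mono mult_mono power_mono) auto
      finally show "norm ((E0 - E) * \<psi> t * \<eta> t) \<le> K" by (simp add: K_def)
    qed (use x in auto)
    also have "\<dots> \<le> K * (c - a)" using x K by (intro mult_left_mono) auto
    finally show ?thesis by (simp add: W0)
  qed
  have "norm (w x0 - w z) \<le> (K * (c - a) / m\<^sup>2) * norm (x0 - z)"
  proof (rule field_differentiable_bound[where S = "{a..c}", OF _ dw])
    fix t assume t: "t \<in> {a..c}"
    have "\<bar>W t\<bar> / (\<psi> t)\<^sup>2 \<le> (K * (c - a)) / m\<^sup>2"
      using W[OF t] bounds[OF t] m by (intro frac_le power_mono) auto
    then show "norm (W t / (\<psi> t)\<^sup>2) \<le> K * (c - a) / m\<^sup>2" by simp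
  qed (use x0 z in auto)
  also have "\<dots> \<le> (K * (c - a) / m\<^sup>2) * (c - a)"
    using x0 z(1) K ac by (intro mult_left_mono) auto
  finally have "N \<le> (K * (c - a) / m\<^sup>2) * (c - a)" by (simp add: wz N_def)
  also have "\<dots> = N * (\<bar>E - E0\<bar> * (M\<^sup>2 * (c - a)\<^sup>2 / m\<^sup>2))"
    unfolding K_def power2_eq_square[of "c - a"] by simp
  finally have "N * 1 \<le> N * (\<bar>E - E0\<bar> * (M\<^sup>2 * (c - a)\<^sup>2 / m\<^sup>2))" by simp
  then have *: "1 \<le> \<bar>E - E0\<bar> * (M\<^sup>2 * (c - a)\<^sup>2 / m\<^sup>2)"
    using N by (simp only: mult_le_cancel_left_pos)
  have "0 < M\<^sup>2 * (c - a)\<^sup>2 / m\<^sup>2" using m M ac by simp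
  then have "1 / (M\<^sup>2 * (c - a)\<^sup>2 / m\<^sup>2) \<le> \<bar>E - E0\<bar>" using * by (simp only: pos_divide_le_eq)
  then show ?thesis by (simp add: power_divide)
qed

section \<open>Real solutions and complex eigenspaces\<close>

lemma multiplicity_eq_zero:
  assumes "\<And>f x. f \<in> eigenspace v L E \<Longrightarrow> f x = 0"
  shows "multiplicity_of v L E = 0"
  unfolding multiplicity_of_def
proof (rule cfun.dim_unique[where B = "{}"])
  show "eigenspace v L E \<subseteq> cfun.span {}" using assms by (auto simp: fun_eq_iff)
qed (auto simp: cfun.independent_empty)

lemma multiplicity_eq_one:
  assumes "\<psi> \<in> eigenspace v L E" and "\<psi> y \<noteq> 0"
    and "\<And>f. f \<in> eigenspace v L E \<Longrightarrow> \<exists>k. \<forall>x. f x = k * \<psi> x"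
  shows "multiplicity_of v L E = 1"
  unfolding multiplicity_of_def
proof (rule cfun.dim_unique[where B = "{\<psi>}"])
  show "eigenspace v L E \<subseteq> cfun.span {\<psi>}"
    using assms(3) by (force simp: cfun.span_singleton fun_eq_iff)
  show "cfun.independent {\<psi>}"
    using assms(2) by (auto simp: fun_eq_iff)
qed (use assms in auto)

text \<open>The potential and \<open>E\<close> are real, so real and imaginary part of an eigenfunction solve the
equation separately. Changing \<open>v\<close> on a null set does not affect the integrated equation.\<close>

lemma eigenspace_real_parts:
  assumes ae: "AE x in lebesgue. v x = w x" and "f \<in> eigenspace v L E"
  obtains f' where
    "ode_on (\<lambda>t. w t - E) (-L/2) (L/2) (\<lambda>x. Re (f x)) (\<lambda>x. Re (f' x))"
    "ode_on (\<lambda>t. w t - E) (-L/2) (L/2) (\<lambda>x. Im (f x)) (\<lambda>x. Im (f' x))"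
    "f' (-L/2) = 0" "f' (L/2) = 0" "\<And>x. x \<notin> {-L/2..L/2} \<Longrightarrow> f x = 0"
proof -
  let ?O = "{-L/2<..<L/2}" and ?C = "{-L/2..L/2}"
  obtain f' f'' where nm: "neumann_H2 L f f' f''"
    and eq: "AE x in lebesgue_on ?O. - f'' x + of_real (v x) * f x = of_real E * f x"
    using assms(2) by (auto simp: eigenspace_def schroedinger_neumann_def)
  have zero: "\<And>x. x \<notin> ?C \<Longrightarrow> f x = 0"
    and der: "\<And>x. x \<in> ?C \<Longrightarrow> (f has_vector_derivative f' x) (at x within ?C)"
    and L2: "f'' \<in> L2_on ?O"
    and int: "\<And>x. x \<in> ?C \<Longrightarrow> f' x = f' (-L/2) + (LINT t:{-L/2..x}|lebesgue. f'' t)"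
    and bc: "f' (-L/2) = 0" "f' (L/2) = 0"
    using nm unfolding neumann_H2_def by auto
  have "integrable (lebesgue_on ?O) f''"
  proof (rule Bochner_Integration.integrable_bound)
    show "integrable (lebesgue_on ?O) (\<lambda>x. 1 + (norm (f'' x))\<^sup>2)"
      using L2 by (intro Bochner_Integration.integrable_add finite_measure.integrable_const finite_measure_lebesgue_on)
        (auto simp: L2_on_def)
    show "f'' \<in> borel_measurable (lebesgue_on ?O)" using L2 by (simp add: L2_on_def)
    have "norm z \<le> norm (1 + (norm z)\<^sup>2)" for z :: complex
    proof -
      have "0 \<le> (norm z - 1)\<^sup>2" by simp
      also have "\<dots> = 1 + (norm z)\<^sup>2 - 2 * norm z" by (simp add: power2_eq_square algebra_simps)
      finally have "2 * norm z \<le> 1 + (norm z)\<^sup>2" by simp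
      then show ?thesis using norm_ge_zero[of z] by (simp del: norm_ge_zero)
    qed
    then show "AE x in lebesgue_on ?O. norm (f'' x) \<le> norm (1 + (norm (f'' x))\<^sup>2)" by simp
  qed
  then have "f'' absolutely_integrable_on ?O" by (simp add: set_integrable_def integrable_restrict_space)
  then have absC: "f'' absolutely_integrable_on ?C"
    by (rule absolutely_integrable_spike_set)
      (auto intro!: negligible_subset[OF negligible_finite[of "{-L/2, L/2}"]])
  from ae obtain N1 where N1: "negligible N1" "{x. \<not> v x = w x} \<subseteq> N1"
    by (auto simp: eventually_ae_filter_negligible)
  from eq have "AE x in lebesgue. x \<in> ?O \<longrightarrow> - f'' x + of_real (v x) * f x = of_real E * f x"
    by (subst (asm) AE_restrict_space_iff) auto
  then obtain N2 where N2: "negligible N2"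
    "{x. \<not> (x \<in> ?O \<longrightarrow> - f'' x + of_real (v x) * f x = of_real E * f x)} \<subseteq> N2"
    unfolding eventually_ae_filter_negligible by blast
  have hi: "((\<lambda>t. of_real (w t - E) * f t) has_integral f' x) {-L/2..x}" if x: "x \<in> ?C" for x
  proof (rule has_integral_spike)
    show "negligible (N1 \<union> N2 \<union> {-L/2, L/2})" using N1 N2 by (simp add: negligible_Un_eq)
    have "set_integrable lebesgue {-L/2..x} f''"
      by (rule set_integrable_subset[OF absC]) (use x in auto)
    then have "(f'' has_integral (LINT t:{-L/2..x}|lebesgue. f'' t)) {-L/2..x}"
      by (rule has_integral_set_lebesgue)
    then show "(f'' has_integral f' x) {-L/2..x}" using int[OF x] bc by simp
    fix t assume t: "t \<in> {-L/2..x} - (N1 \<union> N2 \<union> {-L/2, L/2})"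
    then have "t \<in> ?O" using x by auto
    then have "- f'' t + of_real (w t) * f t = of_real E * f t"
    proof -
      have "v t = w t" using N1(2) t by blast
      moreover have "- f'' t + of_real (v t) * f t = of_real E * f t" using N2(2) t \<open>t \<in> ?O\<close> by blast
      ultimately show ?thesis by simp
    qed
    then show "of_real (w t - E) * f t = f'' t" by (simp add: algebra_simps)
  qed
  have main: "ode_on (\<lambda>t. w t - E) (-L/2) (L/2) (\<lambda>x. T (f x)) (\<lambda>x. T (f' x))"
    if T: "bounded_linear T" and Tr: "\<And>r z. T (of_real r * z) = r * T z" for T :: "complex \<Rightarrow> real"
  proof (rule ode_onI)
    fix x assume x: "x \<in> ?C"
    show "((\<lambda>x. T (f x)) has_real_derivative T (f' x)) (at x within ?C)"
      unfolding has_real_derivative_iff_has_vector_derivative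
      by (rule bounded_linear.has_vector_derivative[OF T der[OF x]])
    have "T 0 = 0" using T by (simp add: linear_simps)
    then show "((\<lambda>t. (w t - E) * T (f t)) has_integral T (f' x) - T (f' (-L/2))) {-L/2..x}"
      using has_integral_linear[OF hi[OF x] T] bc by (simp add: o_def Tr del: of_real_diff)
  qed
  show thesis
  proof (rule that)
    show "ode_on (\<lambda>t. w t - E) (-L/2) (L/2) (\<lambda>x. Re (f x)) (\<lambda>x. Re (f' x))"
      by (rule main[OF bounded_linear_Re]) simp
    show "ode_on (\<lambda>t. w t - E) (-L/2) (L/2) (\<lambda>x. Im (f x)) (\<lambda>x. Im (f' x))"
      by (rule main[OF bounded_linear_Im]) simp
  qed (use zero bc in blast)+
qed

lemma eigenspaceI:
  assumes ae: "AE x in lebesgue. v x = w x" and wm: "w \<in> borel_measurable lebesgue"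
    and bd: "\<And>t. \<bar>w t\<bar> \<le> R" and L: "0 < L"
    and f: "ode_on (\<lambda>t. w t - E) (-L/2) (L/2) f f'" and bc: "f' (-L/2) = 0" "f' (L/2) = 0"
  shows "(\<lambda>x. if x \<in> {-L/2..L/2} then complex_of_real (f x) else 0) \<in> eigenspace v L E"
proof -
  let ?O = "{-L/2<..<L/2}" and ?C = "{-L/2..L/2}"
  define \<psi> where "\<psi> = (\<lambda>x. if x \<in> ?C then complex_of_real (f x) else 0)"
  define h where "h = (\<lambda>t. (w t - E) * f t)"
  have qm: "(\<lambda>t. w t - E) \<in> borel_measurable lebesgue" using wm by simp
  have qbd: "\<bar>w t - E\<bar> \<le> R + \<bar>E\<bar>" for t using bd[of t] by linarith
  have R: "0 \<le> R" using bd[of 0] by linarith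
  have habs: "h absolutely_integrable_on ?C"
    unfolding h_def by (rule bounded_times_continuous_integrable[OF qm qbd ode_on_continuous[OF f]])
  then have "set_integrable lebesgue ?O h" by (rule set_integrable_subset) auto
  then have "integrable (lebesgue_on ?O) h" by (simp add: set_integrable_def integrable_restrict_space)
  then have hm: "h \<in> borel_measurable (lebesgue_on ?O)" by (rule borel_measurable_integrable)
  obtain B where B: "\<And>x. x \<in> ?C \<Longrightarrow> \<bar>f x\<bar> \<le> B"
    using abs_attains_max_on_interval[OF _ ode_on_continuous[OF f]] L by fastforce
  have hB: "\<bar>h x\<bar> \<le> (R + \<bar>E\<bar>) * B" if "x \<in> ?C" for x
    unfolding h_def abs_mult using R by (intro mult_mono qbd B that) auto
  have "neumann_H2 L \<psi> (\<lambda>x. of_real (f' x)) (\<lambda>x. of_real (h x))"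
    unfolding neumann_H2_def
  proof (intro conjI allI impI ballI)
    fix x assume x: "x \<in> ?C"
    have "((\<lambda>x. complex_of_real (f x)) has_vector_derivative of_real (f' x)) (at x within ?C)"
      using bounded_linear.has_vector_derivative[OF bounded_linear_of_real] ode_on_deriv[OF f x]
      by (simp add: has_real_derivative_iff_has_vector_derivative)
    then show "(\<psi> has_vector_derivative of_real (f' x)) (at x within ?C)"
      by (rule has_vector_derivative_transform[OF x, rotated]) (simp add: \<psi>_def)
  next
    have "integrable (lebesgue_on ?O) (\<lambda>x. (norm (complex_of_real (h x)))\<^sup>2)"
    proof (rule finite_measure.integrable_const_bound[OF finite_measure_lebesgue_on])
      show "AE x in lebesgue_on ?O. norm ((norm (complex_of_real (h x)))\<^sup>2) \<le> ((R + \<bar>E\<bar>) * B)\<^sup>2"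
      proof (rule AE_I2)
        fix x assume "x \<in> space (lebesgue_on ?O)"
        then have "\<bar>h x\<bar> \<le> (R + \<bar>E\<bar>) * B" by (intro hB) auto
        then have "\<bar>h x\<bar>\<^sup>2 \<le> ((R + \<bar>E\<bar>) * B)\<^sup>2" by (rule power_mono) simp
        then show "norm ((norm (complex_of_real (h x)))\<^sup>2) \<le> ((R + \<bar>E\<bar>) * B)\<^sup>2" by simp
      qed
      show "(\<lambda>x. (norm (complex_of_real (h x)))\<^sup>2) \<in> borel_measurable (lebesgue_on ?O)"
        using hm by measurable
    qed auto
    then show "(\<lambda>x. complex_of_real (h x)) \<in> L2_on ?O" using hm by (simp add: L2_on_def)
  next
    fix x assume x: "x \<in> ?C"
    have "set_integrable lebesgue {-L/2..x} h"
      by (rule set_integrable_subset[OF habs]) (use x in auto)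
    then have "(h has_integral (LINT t:{-L/2..x}|lebesgue. h t)) {-L/2..x}"
      by (rule has_integral_set_lebesgue)
    moreover have "(h has_integral (f' x - f' (-L/2))) {-L/2..x}"
      unfolding h_def by (rule ode_on_integral[OF f]) (use x in auto)
    ultimately have "(LINT t:{-L/2..x}|lebesgue. h t) = f' x - f' (-L/2)" by (rule has_integral_unique)
    then show "complex_of_real (f' x) = of_real (f' (-L/2)) + (LINT t:{-L/2..x}|lebesgue. of_real (h t))"
      by (simp add: set_integral_complex_of_real)
  qed (use bc in \<open>auto simp: \<psi>_def\<close>)
  moreover have "AE x in lebesgue_on ?O. - complex_of_real (h x) + of_real (v x) * \<psi> x = of_real E * \<psi> x"
  proof -
    have "AE x in lebesgue. x \<in> ?O \<longrightarrow> - complex_of_real (h x) + of_real (v x) * \<psi> x = of_real E * \<psi> x"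
      using ae
    proof eventually_elim
      case (elim x)
      have "complex_of_real (h x) = (of_real (w x) - of_real E) * of_real (f x)" by (simp add: h_def)
      then show ?case using elim by (auto simp: \<psi>_def algebra_simps)
    qed
    then show ?thesis by (subst AE_restrict_space_iff) auto
  qed
  ultimately show ?thesis unfolding eigenspace_def schroedinger_neumann_def \<psi>_def by blast
qed

section \<open>Even and odd eigenfunctions by shooting\<close>

lemma even_extension:
  assumes l: "0 \<le> l" and g: "ode_on q 0 l g g'" and even: "\<And>x. q (- x) = q x" and "g' 0 = 0"
  shows "ode_on q (- l) l (\<lambda>x. g \<bar>x\<bar>) (\<lambda>x. if x \<le> 0 then - g' (- x) else g' x)"
proof -
  have "ode_on q (- l) l (\<lambda>x. if x \<le> 0 then g (- x) else g x) (\<lambda>x. if x \<le> 0 then - g' (- x) else g' x)"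
    using ode_on_reflect[OF g even] g assms by (intro ode_on_glue) auto
  moreover have "(\<lambda>x. if x \<le> 0 then g (- x) else g x) = (\<lambda>x. g \<bar>x\<bar>)" by (auto simp: fun_eq_iff)
  ultimately show ?thesis by simp
qed

lemma odd_extension:
  assumes l: "0 \<le> l" and g: "ode_on q 0 l g g'" and even: "\<And>x. q (- x) = q x" and "g 0 = 0"
  shows "ode_on q (- l) l (\<lambda>x. if x \<le> 0 then - g (- x) else g x) (\<lambda>x. g' \<bar>x\<bar>)"
proof -
  have "ode_on q (- l) l (\<lambda>x. if x \<le> 0 then - g (- x) else g x) (\<lambda>x. if x \<le> 0 then g' (- x) else g' x)"
    using ode_on_cmult[OF ode_on_reflect[OF g even], of "- 1"] g assms by (intro ode_on_glue) auto
  moreover have "(\<lambda>x. if x \<le> 0 then g' (- x) else g' x) = (\<lambda>x. g' \<bar>x\<bar>)" by (auto simp: fun_eq_iff)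
  ultimately show ?thesis by simp
qed

text \<open>The comparison function \<open>\<phi>\<close> may vanish at \<open>0\<close>, as odd eigenfunctions do, so proportionality is
obtained on each \<open>[x, l]\<close> with \<open>x > 0\<close> and extended to \<open>0\<close> by continuity. The slopes at \<open>0\<close> follow
from the integrated equation; they are what links the two halves of the full interval.\<close>

lemma half_interval_proportional:
  assumes l: "0 < l" and bd: "\<And>t. \<bar>v t\<bar> \<le> R"
    and \<phi>: "ode_on (\<lambda>t. v t - E) 0 l \<phi> \<phi>'" and \<eta>: "ode_on (\<lambda>t. v t - E) 0 l \<eta> \<eta>'"
    and bc: "\<phi>' l = 0" "\<eta>' l = 0" and pos: "\<And>t. t \<in> {0<..l} \<Longrightarrow> 0 < \<phi> t"
  obtains k where "\<And>x. x \<in> {0..l} \<Longrightarrow> \<eta> x = k * \<phi> x" and "\<eta>' 0 = k * \<phi>' 0"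
proof -
  define k where "k = \<eta> l / \<phi> l"
  have "\<eta> x = k * \<phi> x" if x: "x \<in> {0<..l}" for x
    unfolding k_def
    by (rule same_energy_proportional[where a = x and c = l and v = v and R = R and E = E and \<psi>' = \<phi>' and \<eta>' = \<eta>'])
      (use x bd pos bc in \<open>auto intro: ode_on_subset[OF \<phi>] ode_on_subset[OF \<eta>]\<close>)
  then have *: "\<eta> x - k * \<phi> x = 0" if "x \<in> {0<..l}" for x using that by simp
  have eq: "\<eta> x = k * \<phi> x" if x: "x \<in> {0..l}" for x
  proof -
    have cl: "closure {0<..l} = {0..l}" using l by simp
    have "\<eta> x - k * \<phi> x = 0"
    proof (rule continuous_constant_on_closure[where f = "\<lambda>x. \<eta> x - k * \<phi> x" and S = "{0<..l}"])
      show "continuous_on (closure {0<..l}) (\<lambda>x. \<eta> x - k * \<phi> x)"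
        unfolding cl by (intro continuous_intros ode_on_continuous[OF \<phi>] ode_on_continuous[OF \<eta>])
      show "x \<in> closure {0<..l}" using x cl by simp
    qed (rule *)
    then show ?thesis by simp
  qed
  have "((\<lambda>t. (v t - E) * \<eta> t) has_integral (k * \<phi>' l - k * \<phi>' 0)) {0..l}"
    by (rule has_integral_eq[OF _ ode_on_integral[OF ode_on_cmult[OF \<phi>]]]) (use l eq in auto)
  then have "\<eta>' l - \<eta>' 0 = k * \<phi>' l - k * \<phi>' 0"
    using ode_on_integral[OF \<eta>, of 0 l] l has_integral_unique by (metis less_imp_le order_refl)
  then have "\<eta>' 0 = k * \<phi>' 0" using bc by simp
  with eq show thesis by (rule that)
qed

lemma ivp_value_continuous:
  assumes b: "0 < b" and small: "b\<^sup>2 * R \<le> 1/2"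
    and w: "\<And>t. t \<in> {0..b} \<Longrightarrow> 0 \<le> w t \<and> w t \<le> R"
    and P: "\<And>t. t \<in> {0..b} \<Longrightarrow> \<bar>p + s * t\<bar> \<le> P"
    and Y: "\<And>E. E \<in> {0..R} \<Longrightarrow> ode_on (\<lambda>t. w t - E) 0 b (Y E) (Y' E) \<and> Y E 0 = p \<and> Y' E 0 = s"
  shows "continuous_on {0..R} (\<lambda>E. Y E b)" and "continuous_on {0..R} (\<lambda>E. Y' E b)"
proof -
  have P0: "0 \<le> P" using P[of 0] b by force
  have qbd: "\<bar>w t - E\<bar> \<le> R" if "t \<in> {0..b}" "E \<in> {0..R}" for t E
    using w[OF that(1)] that(2) by (auto simp: abs_le_iff)
  have bb: "b \<in> {0..b}" using b by simp
  have Ybd: "\<bar>Y E t\<bar> \<le> 4/3 * P" if "E \<in> {0..R}" "t \<in> {0..b}" for E t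
  proof -
    have "\<bar>Y E t - (p + s * t)\<bar> \<le> P / 3"
      by (rule ivp_near_affine(1)[OF b small qbd[OF _ that(1)], where y' = "Y' E"]) (use Y[OF that(1)] that P in auto)
    then show ?thesis using P[OF that(2)] by linarith
  qed
  have cmp: "\<bar>Y E b - Y F b\<bar> \<le> 2/3 * (\<bar>E - F\<bar> * (4/3 * P) * b\<^sup>2)"
     "\<bar>Y' E b - Y' F b\<bar> \<le> 4/3 * (\<bar>E - F\<bar> * (4/3 * P) * b)" if E: "E \<in> {0..R}" and F: "F \<in> {0..R}" for E F
  proof -
    have d: "\<bar>(w t - E) - (w t - F)\<bar> \<le> \<bar>E - F\<bar>" for t by simp
    have yE: "ode_on (\<lambda>t. w t - E) 0 b (Y E) (Y' E)" and yF: "ode_on (\<lambda>t. w t - F) 0 b (Y F) (Y' F)"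
      and init: "Y E 0 = Y F 0" "Y' E 0 = Y' F 0"
      using Y[OF E] Y[OF F] by auto
    note c = ivp_compare[OF b small qbd[OF _ E] d yE yF init Ybd[OF F] bb]
    show "\<bar>Y E b - Y F b\<bar> \<le> 2/3 * (\<bar>E - F\<bar> * (4/3 * P) * b\<^sup>2)" by (rule c(1))
    show "\<bar>Y' E b - Y' F b\<bar> \<le> 4/3 * (\<bar>E - F\<bar> * (4/3 * P) * b)" by (rule c(2))
  qed
  have "(2/3 * (4/3 * P) * b\<^sup>2)-lipschitz_on {0..R} (\<lambda>E. Y E b)"
    using cmp(1) P0 b by (intro lipschitz_onI) (auto simp: dist_real_def mult_ac)
  then show "continuous_on {0..R} (\<lambda>E. Y E b)" by (rule lipschitz_on_continuous_on)
  have "(4/3 * (4/3 * P) * b)-lipschitz_on {0..R} (\<lambda>E. Y' E b)"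
    using cmp(2) P0 b by (intro lipschitz_onI) (auto simp: dist_real_def mult_ac)
  then show "continuous_on {0..R} (\<lambda>E. Y' E b)" by (rule lipschitz_on_continuous_on)
qed

text \<open>The condition \<open>y' b * cos (k * d) = y b * (k * sin (k * d))\<close> says that \<open>y\<close> continues beyond
\<open>b\<close> as a multiple of \<open>cos (k (b + d - x))\<close>. The difference of its two sides is nonnegative at
\<open>k = 0\<close> by \<open>slope\<close>, and negative at \<open>k = \<pi> / (2 d)\<close>, where the cosine vanishes, by \<open>pos\<close>.\<close>

lemma matching_energy:
  assumes b: "0 < b" and small: "b\<^sup>2 * R \<le> 1/2" and d: "0 < d" and K: "(pi / (2 * d))\<^sup>2 \<le> R"
    and wm: "w \<in> borel_measurable lebesgue"
    and w: "\<And>t. t \<in> {0..b} \<Longrightarrow> 0 \<le> w t \<and> w t \<le> R"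
    and P: "\<And>t. t \<in> {0..b} \<Longrightarrow> \<bar>p + s * t\<bar> \<le> P"
    and pos: "\<And>E y y'. E \<in> {0..R} \<Longrightarrow> ode_on (\<lambda>t. w t - E) 0 b y y' \<Longrightarrow> y 0 = p \<Longrightarrow> y' 0 = s \<Longrightarrow> 0 < y b"
    and slope: "\<And>y y'. ode_on (\<lambda>t. w t - 0) 0 b y y' \<Longrightarrow> y 0 = p \<Longrightarrow> y' 0 = s \<Longrightarrow> 0 \<le> y' b"
  obtains k y y' where "0 \<le> k" "k * d < pi / 2" "k\<^sup>2 \<in> {0..R}"
    "ode_on (\<lambda>t. w t - k\<^sup>2) 0 b y y'" "y 0 = p" "y' 0 = s"
    "y' b * cos (k * d) = y b * (k * sin (k * d))"
proof -
  define k1 where "k1 = pi / (2 * d)"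
  have k1: "0 < k1" "k1 * d = pi / 2" using d by (auto simp: k1_def)
  have "\<forall>E\<in>{0..R}. \<exists>y y'. ode_on (\<lambda>t. w t - E) 0 b y y' \<and> y 0 = p \<and> y' 0 = s"
    by (intro ballI ivp_exists[OF b small]) (use wm w in \<open>force simp: abs_le_iff\<close>)+
  then obtain Y Y' where Y: "\<And>E. E \<in> {0..R} \<Longrightarrow>
      ode_on (\<lambda>t. w t - E) 0 b (Y E) (Y' E) \<and> Y E 0 = p \<and> Y' E 0 = s"
    by metis
  note Yc = ivp_value_continuous[OF b small w P Y]
  have k2: "k\<^sup>2 \<in> {0..R}" if "k \<in> {0..k1}" for k
  proof -
    have "k\<^sup>2 \<le> k1\<^sup>2" using that by (intro power_mono) auto
    then show ?thesis using K by (simp add: k1_def)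
  qed
  define h where "h = (\<lambda>k. Y' (k\<^sup>2) b * cos (k * d) - Y (k\<^sup>2) b * (k * sin (k * d)))"
  have hc: "continuous_on {0..k1} h"
  proof -
    have "continuous_on {0..k1} (\<lambda>k. Y (k\<^sup>2) b)" "continuous_on {0..k1} (\<lambda>k. Y' (k\<^sup>2) b)"
      by (rule continuous_on_compose2[OF Yc(1)] continuous_on_compose2[OF Yc(2)];
          use k2 in \<open>auto intro!: continuous_intros\<close>)+
    then show ?thesis unfolding h_def by (intro continuous_intros)
  qed
  have 0: "0 \<in> {0..k1}" and 1: "k1 \<in> {0..k1}" using k1 by auto
  have h0: "0 \<le> h 0" using slope[of "Y 0" "Y' 0"] Y[of 0] k2[OF 0] by (simp add: h_def)
  have "h k1 = - (Y (k1\<^sup>2) b * k1)" unfolding h_def k1(2) by simp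
  moreover have "0 < Y (k1\<^sup>2) b" using pos[OF k2[OF 1]] Y[OF k2[OF 1]] by blast
  ultimately have h1: "h k1 < 0" using k1(1) by simp
  obtain k where k: "0 \<le> k" "k \<le> k1" "h k = 0"
    using IVT2'[of h k1 0 0] hc h0 h1 k1 by auto
  then have "k \<noteq> k1" using h1 by auto
  then have "k * d < k1 * d" using k d by (intro mult_strict_right_mono) auto
  show thesis
    by (rule that[of k "Y (k\<^sup>2)" "Y' (k\<^sup>2)"])
      (use k \<open>k * d < k1 * d\<close> k1 Y[of "k\<^sup>2"] k2[of k] in \<open>auto simp: h_def\<close>)
qed

lemma matched_solution:
  assumes b: "0 < b" "b \<le> l" and k: "0 \<le> k" "k * (l - b) < pi / 2"
    and w: "\<And>t. b \<le> t \<Longrightarrow> w t = 0"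
    and y: "ode_on (\<lambda>t. w t - k\<^sup>2) 0 b y y'"
    and match: "y' b * cos (k * (l - b)) = y b * (k * sin (k * (l - b)))"
    and A: "A = y b / cos (k * (l - b))"
  shows "ode_on (\<lambda>t. w t - k\<^sup>2) 0 l (\<lambda>x. if x \<le> b then y x else A * cos (k * (l - x)))
      (\<lambda>x. if x \<le> b then y' x else A * k * sin (k * (l - x)))"
proof (rule ode_on_glue[OF y])
  have "0 \<le> k * (l - b)" using k b by simp
  then have c: "0 < cos (k * (l - b))" using k by (intro cos_gt_zero_pi) auto
  show "y b = A * cos (k * (l - b))" using c by (simp add: A)
  show "y' b = A * k * sin (k * (l - b))" using match c by (simp add: A field_simps)
  have D: "((\<lambda>x. A * cos (k * (l - x))) has_real_derivative A * k * sin (k * (l - x))) (at x within S)" for x S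
    by (auto intro!: derivative_eq_intros)
  have D': "((\<lambda>x. A * k * sin (k * (l - x))) has_real_derivative - (k\<^sup>2) * (A * cos (k * (l - x)))) (at x within S)" for x S
    by (auto intro!: derivative_eq_intros simp: power2_eq_square)
  show "ode_on (\<lambda>t. w t - k\<^sup>2) b l (\<lambda>x. A * cos (k * (l - x))) (\<lambda>x. A * k * sin (k * (l - x)))"
  proof (rule ode_onI)
    fix x assume x: "x \<in> {b..l}"
    have "((\<lambda>t. - (k\<^sup>2) * (A * cos (k * (l - t)))) has_integral
        (A * k * sin (k * (l - x)) - A * k * sin (k * (l - b)))) {b..x}"
      using x D' by (intro fundamental_theorem_of_calculus)
        (auto simp: has_real_derivative_iff_has_vector_derivative[symmetric])
    then show "((\<lambda>t. (w t - k\<^sup>2) * (A * cos (k * (l - t)))) has_integral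
        (A * k * sin (k * (l - x)) - A * k * sin (k * (l - b)))) {b..x}"
      by (rule has_integral_eq[rotated]) (simp add: w)
  qed (rule D)
qed (use b in auto)

text \<open>If the cosine is below \<open>1/2\<close>, then the sine is at least \<open>1/2\<close> and so is the angle, whence
\<open>k \<ge> 1 / (2 l)\<close>. The right-hand side of the matching condition is then at least \<open>1 / (6 l)\<close>, and
the bound on \<open>y'\<close> forces the cosine to be of order \<open>b / l\<close>.\<close>

lemma matched_cos_bound:
  fixes b l :: real
  assumes b: "0 < b" "b < l" and k: "0 \<le> k" "k * (l - b) < pi / 2"
    and match: "y' * cos (k * (l - b)) = y * (k * sin (k * (l - b)))"
    and y: "2/3 \<le> y" and y': "y' \<le> 2 / (3 * b)"
  shows "b / (4 * l) \<le> cos (k * (l - b))"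
proof -
  define \<theta> where "\<theta> = k * (l - b)"
  have \<theta>: "0 \<le> \<theta>" "\<theta> < pi / 2" using k b by (auto simp: \<theta>_def)
  have c0: "0 < cos \<theta>" using \<theta> by (intro cos_gt_zero_pi) auto
  have s0: "0 \<le> sin \<theta>" using \<theta> by (intro sin_ge_zero) auto
  show ?thesis
  proof (cases "1/2 \<le> cos \<theta>")
    case True
    have "b / (4 * l) \<le> 1/2" using b by (simp add: field_simps)
    then show ?thesis using True by (simp add: \<theta>_def)
  next
    case False
    then have "(cos \<theta>)\<^sup>2 \<le> (1/2)\<^sup>2" using c0 by (intro power_mono) auto
    then have "(1/2)\<^sup>2 \<le> (sin \<theta>)\<^sup>2" using sin_cos_squared_add[of \<theta>] by (simp add: power2_eq_square)
    then have s: "1/2 \<le> sin \<theta>" using s0 by (rule power2_le_imp_le)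
    then have "1/2 \<le> k * (l - b)" using sin_x_le_x[OF \<theta>(1)] by (simp add: \<theta>_def)
    also have "\<dots> \<le> k * l" using k b by (intro mult_left_mono) auto
    finally have kl: "1 / (2 * l) \<le> k" using b by (simp add: field_simps)
    have "(2/3) * ((1 / (2 * l)) * (1/2)) \<le> y * (k * sin \<theta>)"
      using y kl s b k by (intro mult_mono) auto
    also have "\<dots> = y' * cos \<theta>" using match by (simp add: \<theta>_def)
    also have "\<dots> \<le> 2 / (3 * b) * cos \<theta>" using y' c0 by (intro mult_right_mono) auto
    finally show ?thesis using b by (simp add: \<theta>_def field_simps)
  qed
qed

lemma even_ivp_bounds:
  assumes b: "0 < b" and R: "R = 1 / (2 * b\<^sup>2)" and E: "E \<in> {0..R}"
    and w: "\<And>t. t \<in> {0..b} \<Longrightarrow> 0 \<le> w t \<and> w t \<le> R"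
    and y: "ode_on (\<lambda>t. w t - E) 0 b y y'" "y 0 = 1" "y' 0 = 0" and x: "x \<in> {0..b}"
  shows "2/3 \<le> y x" "y x \<le> 4/3" "y' x \<le> 2 / (3 * b)"
proof -
  have small: "b\<^sup>2 * R \<le> 1/2" using b by (simp add: R)
  have q: "\<bar>w t - E\<bar> \<le> R" if "t \<in> {0..b}" for t using w[OF that] E by (auto simp: abs_le_iff)
  note near = ivp_near_affine[OF b small q y, of 1, OF _ _ x]
  have "\<bar>y x - 1\<bar> \<le> 1/3" using near(1) by simp
  then show "2/3 \<le> y x" "y x \<le> 4/3" by linarith+
  have "y' x \<le> 4/3 * (R * b)" using near(2) by simp
  also have "\<dots> = 2 / (3 * b)" using b by (simp add: R power2_eq_square)
  finally show "y' x \<le> 2 / (3 * b)" .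
qed

text \<open>The comparison with the affine function is made on \<open>[0, x]\<close> instead of \<open>[0, b]\<close>: there its
error is proportional to \<open>x\<close>, which gives positivity all the way down to the origin.\<close>

lemma odd_ivp_bounds:
  assumes b: "0 < b" and small: "b\<^sup>2 * R \<le> 1/2" and E: "E \<in> {0..R}"
    and w: "\<And>t. t \<in> {0..b} \<Longrightarrow> 0 \<le> w t \<and> w t \<le> R"
    and y: "ode_on (\<lambda>t. w t - E) 0 b y y'" "y 0 = 0" "y' 0 = 1" and x: "x \<in> {0<..b}"
  shows "0 < y x" "0 \<le> y' x"
proof -
  have x0: "0 < x" and xb: "x \<le> b" using x by auto
  have "x\<^sup>2 * R \<le> b\<^sup>2 * R" using x E by (intro mult_right_mono power_mono) auto
  then have sx: "x\<^sup>2 * R \<le> 1/2" using small by linarith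
  have q: "\<bar>w t - E\<bar> \<le> R" if "t \<in> {0..x}" for t using w[of t] that xb E by (auto simp: abs_le_iff)
  have yx: "ode_on (\<lambda>t. w t - E) 0 x y y'" by (rule ode_on_subset[OF y(1)]) (use xb in auto)
  have P: "\<bar>0 + 1 * t\<bar> \<le> x" if "t \<in> {0..x}" for t using that by simp
  have xx: "x \<in> {0..x}" using x0 by simp
  note near = ivp_near_affine[OF x0 sx q yx y(2,3) P xx]
  have "\<bar>y x - x\<bar> \<le> x / 3" using near(1) by simp
  then show "0 < y x" using x0 by linarith
  have "\<bar>y' x - 1\<bar> \<le> 4/3 * (R * x * x)" using near(2) by simp
  also have "R * x * x = x\<^sup>2 * R" by (simp add: power2_eq_square)
  finally have "\<bar>y' x - 1\<bar> \<le> 2/3" using sx by linarith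
  then show "0 \<le> y' x" by linarith
qed

text \<open>The upper bound is \<open>(4/3) / (b / (4 l))\<close>: the amplitude \<open>A = y b / cos (k (l - b))\<close> with
\<open>even_ivp_bounds\<close> and \<open>matched_cos_bound\<close> inserted.\<close>

lemma positive_even_eigenfunction:
  assumes b: "0 < b" "b < l" and R: "R = 1 / (2 * b\<^sup>2)" and K: "(pi / (2 * (l - b)))\<^sup>2 \<le> R"
    and wm: "w \<in> borel_measurable lebesgue" and w: "\<And>t. 0 \<le> w t \<and> w t \<le> R"
    and even: "\<And>t. w (- t) = w t" and out: "\<And>t. b \<le> t \<Longrightarrow> w t = 0"
  obtains E \<psi> \<psi>' where "ode_on (\<lambda>t. w t - E) (- l) l \<psi> \<psi>'" "\<psi>' (- l) = 0" "\<psi>' l = 0"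
    "\<forall>t\<in>{- l..l}. 2/3 \<le> \<psi> t \<and> \<psi> t \<le> 16 * l / (3 * b)"
proof -
  have small: "b\<^sup>2 * R \<le> 1/2" using b by (simp add: R)
  have bb: "b \<in> {0..b}" using b by simp
  note bounds = even_ivp_bounds[OF b(1) R _ w]
  obtain k y y' where k: "0 \<le> k" "k * (l - b) < pi / 2" "k\<^sup>2 \<in> {0..R}"
    and y: "ode_on (\<lambda>t. w t - k\<^sup>2) 0 b y y'" "y 0 = 1" "y' 0 = 0"
    and match: "y' b * cos (k * (l - b)) = y b * (k * sin (k * (l - b)))"
  proof (rule matching_energy[OF b(1) small _ K wm w, where p = 1 and s = 0 and P = 1])
    fix E y y' assume E: "E \<in> {0..R}" and y: "ode_on (\<lambda>t. w t - E) 0 b y y'" "y 0 = 1" "y' 0 = 0"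
    show "0 < y b" using bounds(1)[OF E y bb] by linarith
  next
    fix y y' assume y: "ode_on (\<lambda>t. w t - 0) 0 b y y'" "y 0 = 1" "y' 0 = 0"
    have R0: "0 \<in> {0..R}" by (simp add: R)
    have "0 \<le> y' b - y' 0"
    proof (rule has_integral_nonneg[OF ode_on_integral[OF y(1)]])
      fix t assume "t \<in> {0..b}"
      then show "0 \<le> (w t - 0) * y t" using bounds(1)[OF R0 y \<open>t \<in> {0..b}\<close>] w[of t] by (intro mult_nonneg_nonneg) auto
    qed (use b in auto)
    then show "0 \<le> y' b" using y by simp
  qed (use b in auto)
  define A where "A = y b / cos (k * (l - b))"
  define g where "g = (\<lambda>x. if x \<le> b then y x else A * cos (k * (l - x)))"
  define g' where "g' = (\<lambda>x. if x \<le> b then y' x else A * k * sin (k * (l - x)))"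
  have g: "ode_on (\<lambda>t. w t - k\<^sup>2) 0 l g g'"
    unfolding g_def g'_def by (rule matched_solution[OF b(1) _ k(1,2) out y(1) match A_def]) (use b in auto)
  have c: "b / (4 * l) \<le> cos (k * (l - b))"
    by (rule matched_cos_bound[OF b k(1,2) match]) (use bounds[OF k(3) y bb] in auto)
  have c0: "0 < cos (k * (l - b))" using c b by (smt (verit) divide_pos_pos)
  have yb: "2/3 \<le> y b" "y b \<le> 4/3" using bounds[OF k(3) y bb] by auto
  have A0: "0 \<le> A" using yb c0 by (simp add: A_def)
  have A1: "A \<le> 16 * l / (3 * b)"
  proof -
    have "A \<le> (4/3) / (b / (4 * l))" unfolding A_def using yb c b by (intro frac_le) auto
    then show ?thesis by simp
  qed
  have l1: "4/3 \<le> 16 * l / (3 * b)" using b by (simp add: field_simps)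
  have gb: "2/3 \<le> g x \<and> g x \<le> 16 * l / (3 * b)" if x: "x \<in> {0..l}" for x
  proof (cases "x \<le> b")
    case True
    then show ?thesis using bounds[OF k(3) y, of x] x l1 by (auto simp: g_def)
  next
    case False
    have "k * (l - b) \<le> pi" using k pi_gt_zero by linarith
    then have "cos (k * (l - b)) \<le> cos (k * (l - x))"
      using k x False by (intro cos_monotone_0_pi_le mult_left_mono) auto
    then have "A * cos (k * (l - b)) \<le> A * cos (k * (l - x))" using A0 by (rule mult_left_mono)
    moreover have "A * cos (k * (l - b)) = y b" using c0 by (simp add: A_def)
    moreover have "A * cos (k * (l - x)) \<le> A" using A0 by (simp add: mult_left_le)
    ultimately show ?thesis using False yb A1 by (simp add: g_def)
  qed
  have ev: "w (- t) - k\<^sup>2 = w t - k\<^sup>2" for t by (simp add: even)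
  have "ode_on (\<lambda>t. w t - k\<^sup>2) (- l) l (\<lambda>x. g \<bar>x\<bar>) (\<lambda>x. if x \<le> 0 then - g' (- x) else g' x)"
    by (rule even_extension[OF _ g ev]) (use b y in \<open>auto simp: g'_def\<close>)
  then show thesis
    by (rule that) (use b gb in \<open>auto simp: g'_def\<close>)
qed

lemma odd_eigenfunction:
  assumes b: "0 < b" "b < l" and small: "b\<^sup>2 * R \<le> 1/2" and K: "(pi / (2 * (l - b)))\<^sup>2 \<le> R"
    and wm: "w \<in> borel_measurable lebesgue" and w: "\<And>t. 0 \<le> w t \<and> w t \<le> R"
    and even: "\<And>t. w (- t) = w t" and out: "\<And>t. b \<le> t \<Longrightarrow> w t = 0"
  obtains E g g' where "ode_on (\<lambda>t. w t - E) 0 l g g'" "g 0 = 0" "g' 0 = 1" "g' l = 0"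
    "\<forall>t\<in>{0<..l}. 0 < g t"
proof -
  have bb: "b \<in> {0<..b}" using b by simp
  have R: "0 \<le> R" using w[of 0] by linarith
  note bounds = odd_ivp_bounds[OF b(1) small _ w]
  obtain k y y' where k: "0 \<le> k" "k * (l - b) < pi / 2" "k\<^sup>2 \<in> {0..R}"
    and y: "ode_on (\<lambda>t. w t - k\<^sup>2) 0 b y y'" "y 0 = 0" "y' 0 = 1"
    and match: "y' b * cos (k * (l - b)) = y b * (k * sin (k * (l - b)))"
  proof (rule matching_energy[OF b(1) small _ K wm w, where p = 0 and s = 1 and P = b])
    show "0 < y b" if "E \<in> {0..R}" "ode_on (\<lambda>t. w t - E) 0 b y y'" "y 0 = 0" "y' 0 = 1" for E y y'
      using bounds(1)[OF that bb] .
    show "0 \<le> y' b" if "ode_on (\<lambda>t. w t - 0) 0 b y y'" "y 0 = 0" "y' 0 = 1" for y y'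
      using bounds(2)[OF _ that bb] R by simp
  qed (use b in auto)
  define A where "A = y b / cos (k * (l - b))"
  define g where "g = (\<lambda>x. if x \<le> b then y x else A * cos (k * (l - x)))"
  define g' where "g' = (\<lambda>x. if x \<le> b then y' x else A * k * sin (k * (l - x)))"
  have g: "ode_on (\<lambda>t. w t - k\<^sup>2) 0 l g g'"
    unfolding g_def g'_def by (rule matched_solution[OF b(1) _ k(1,2) out y(1) match A_def]) (use b in auto)
  have cpos: "0 < cos (k * (l - x))" if "b \<le> x" "x \<le> l" for x
  proof (rule cos_gt_zero_pi)
    have "k * (l - x) \<le> k * (l - b)" using k that by (intro mult_left_mono) auto
    then show "k * (l - x) < pi / 2" using k by linarith
    have "0 \<le> k * (l - x)" using k that by simp
    then show "- (pi / 2) < k * (l - x)" using pi_gt_zero by linarith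
  qed
  have A: "0 < A" unfolding A_def using bounds(1)[OF k(3) y bb] cpos[of b] b by simp
  have pos: "0 < g x" if "x \<in> {0<..l}" for x
    using bounds(1)[OF k(3) y, of x] A cpos[of x] that by (cases "x \<le> b") (auto simp: g_def)
  show thesis
    by (intro that[OF g]) (use b y pos in \<open>auto simp: g_def g'_def\<close>)
qed

section \<open>The spectral gap\<close>

text \<open>The energy \<open>E1\<close> only serves to make the set that defines the second eigenvalue nonempty; the
infimum of the empty set would be an arbitrary number.\<close>

lemma spectral_gap_ge:
  assumes one: "multiplicity_of v L E0 = 1" and E1: "E1 \<noteq> E0" "multiplicity_of v L E1 \<noteq> 0"
    and g: "0 \<le> g" and sep: "\<And>E. E \<noteq> E0 \<Longrightarrow> multiplicity_of v L E \<noteq> 0 \<Longrightarrow> E0 + g \<le> E"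
  shows "g \<le> spectral_gap v L"
proof -
  let ?m = "multiplicity_of v L"
  let ?A = "\<lambda>n. {E. \<exists>F. finite F \<and> F \<subseteq> {..E} \<and> n + 1 \<le> (\<Sum>\<mu>\<in>F. ?m \<mu>)}"
  have low: "E0 \<le> E" if "E \<in> ?A 0" for E
  proof -
    obtain F where F: "finite F" "F \<subseteq> {..E}" "0 + 1 \<le> (\<Sum>\<mu>\<in>F. ?m \<mu>)" using \<open>E \<in> ?A 0\<close> by blast
    then have "(\<Sum>\<mu>\<in>F. ?m \<mu>) \<noteq> 0" by linarith
    then obtain \<mu> where \<mu>: "\<mu> \<in> F" "?m \<mu> \<noteq> 0" by (meson sum.neutral)
    then have "E0 \<le> \<mu>" using sep[of \<mu>] g by (cases "\<mu> = E0") auto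
    then show ?thesis using \<mu> F by auto
  qed
  have "E0 \<in> ?A 0" using one by (intro CollectI exI[of _ "{E0}"]) auto
  moreover have "bdd_below (?A 0)" using low by (intro bdd_belowI) blast
  ultimately have "Inf (?A 0) \<le> E0" by (rule cInf_lower)
  then have 0: "eigenvalue v L 0 \<le> E0" by (simp add: eigenvalue_def)
  have "E0 + g \<le> Inf (?A 1)"
  proof (rule cInf_greatest)
    have "max E0 E1 \<in> ?A 1"
      using one E1 by (intro CollectI exI[of _ "{E0, E1}"]) auto
    then show "?A 1 \<noteq> {}" by blast
    fix E assume "E \<in> ?A 1"
    then obtain F where F: "finite F" "F \<subseteq> {..E}" "1 + 1 \<le> (\<Sum>\<mu>\<in>F. ?m \<mu>)" by blast
    show "E0 + g \<le> E"
    proof (rule ccontr)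
      assume less: "\<not> E0 + g \<le> E"
      have "?m \<mu> = (if \<mu> = E0 then 1 else 0)" if "\<mu> \<in> F" for \<mu>
        using sep[of \<mu>] less F(2) that one by force
      then have "(\<Sum>\<mu>\<in>F. ?m \<mu>) = (\<Sum>\<mu>\<in>F. if \<mu> = E0 then 1 else 0)" by (rule sum.cong[OF refl])
      also have "\<dots> \<le> 1" using F(1) by (simp add: sum.delta)
      finally show False using F(3) by linarith
    qed
  qed
  then have "E0 + g \<le> eigenvalue v L 1" by (simp add: eigenvalue_def)
  with 0 show ?thesis by (simp add: spectral_gap_def)
qed

lemma multiplicity_one_if_proportional:
  assumes ae: "AE x in lebesgue. v x = w x" and wm: "w \<in> borel_measurable lebesgue"
    and bd: "\<And>t. \<bar>w t\<bar> \<le> R" and L: "0 < L"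
    and f: "ode_on (\<lambda>t. w t - E) (-L/2) (L/2) f f'" "f' (-L/2) = 0" "f' (L/2) = 0"
    and y: "y \<in> {-L/2..L/2}" "f y \<noteq> 0"
    and proportional: "\<And>\<eta> \<eta>'. ode_on (\<lambda>t. w t - E) (-L/2) (L/2) \<eta> \<eta>' \<Longrightarrow> \<eta>' (-L/2) = 0 \<Longrightarrow> \<eta>' (L/2) = 0
        \<Longrightarrow> \<exists>k. \<forall>x\<in>{-L/2..L/2}. \<eta> x = k * f x"
  shows "multiplicity_of v L E = 1"
proof (rule multiplicity_eq_one)
  let ?\<psi> = "\<lambda>x. if x \<in> {-L/2..L/2} then complex_of_real (f x) else 0"
  show "?\<psi> \<in> eigenspace v L E" by (rule eigenspaceI[OF ae wm bd L f])
  show "?\<psi> y \<noteq> 0" using y by simp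
  fix h assume "h \<in> eigenspace v L E"
  then obtain h' where h:
    "ode_on (\<lambda>t. w t - E) (-L/2) (L/2) (\<lambda>x. Re (h x)) (\<lambda>x. Re (h' x))"
    "ode_on (\<lambda>t. w t - E) (-L/2) (L/2) (\<lambda>x. Im (h x)) (\<lambda>x. Im (h' x))"
    "h' (-L/2) = 0" "h' (L/2) = 0" "\<And>x. x \<notin> {-L/2..L/2} \<Longrightarrow> h x = 0"
    using eigenspace_real_parts[OF ae] by metis
  obtain k where k: "\<forall>x\<in>{-L/2..L/2}. Re (h x) = k * f x" using proportional[OF h(1)] h(3,4) by auto
  obtain l where l: "\<forall>x\<in>{-L/2..L/2}. Im (h x) = l * f x" using proportional[OF h(2)] h(3,4) by auto
  have "h x = Complex k l * ?\<psi> x" for x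
    using k l h(5)[of x] by (auto simp: complex_eq_iff)
  then show "\<exists>k. \<forall>x. h x = k * ?\<psi> x" by blast
qed

text \<open>Each half of the interval gives its own constant of proportionality. Comparing the slopes at
\<open>0\<close>, where the odd solution has slope \<open>1\<close>, shows that the constants match.\<close>

lemma proportional_to_odd:
  assumes l: "0 < l" and bd: "\<And>t. \<bar>w t\<bar> \<le> R" and even: "\<And>t. w (- t) = w t"
    and g: "ode_on (\<lambda>t. w t - E) 0 l g g'" "g 0 = 0" "g' 0 = 1" "g' l = 0"
    and pos: "\<And>t. t \<in> {0<..l} \<Longrightarrow> 0 < g t"
    and \<eta>: "ode_on (\<lambda>t. w t - E) (- l) l \<eta> \<eta>'" "\<eta>' (- l) = 0" "\<eta>' l = 0"
  shows "\<exists>k. \<forall>x\<in>{- l..l}. \<eta> x = k * (if x \<le> 0 then - g (- x) else g x)"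
proof -
  have ev: "w (- t) - E = w t - E" for t by (simp add: even)
  have r: "ode_on (\<lambda>t. w t - E) (- l) l (\<lambda>x. \<eta> (- x)) (\<lambda>x. - \<eta>' (- x))"
    using ode_on_reflect[OF \<eta>(1) ev] by simp
  have right: "ode_on (\<lambda>t. w t - E) 0 l \<eta> \<eta>'" by (rule ode_on_subset[OF \<eta>(1)]) (use l in auto)
  have left: "ode_on (\<lambda>t. w t - E) 0 l (\<lambda>x. \<eta> (- x)) (\<lambda>x. - \<eta>' (- x))"
    by (rule ode_on_subset[OF r]) (use l in auto)
  obtain k where k: "\<And>x. x \<in> {0..l} \<Longrightarrow> \<eta> x = k * g x" "\<eta>' 0 = k * g' 0"
    using half_interval_proportional[OF l bd g(1) right g(4) \<eta>(3) pos] by metis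
  have "- \<eta>' (- l) = 0" using \<eta> by simp
  then obtain m where m: "\<And>x. x \<in> {0..l} \<Longrightarrow> \<eta> (- x) = m * g x" "- \<eta>' (- 0) = m * g' 0"
    using half_interval_proportional[OF l bd g(1) left g(4) _ pos] by metis
  have "m = - k" using k(2) m(2) g(3) by simp
  have "\<eta> x = k * (if x \<le> 0 then - g (- x) else g x)" if "x \<in> {- l..l}" for x
    using k(1)[of x] m(1)[of "- x"] that \<open>m = - k\<close> by auto
  then show ?thesis by blast
qed

text \<open>For \<open>L \<ge> 10 b\<close> the length \<open>L/2 - b\<close> of the free region is at least \<open>4 b\<close>, so that the energies
\<open>k\<^sup>2\<close> with \<open>k (L/2 - b) \<le> \<pi>/2\<close>, among which the matching takes place, stay below \<open>1 / (2 b\<^sup>2)\<close>. The constant \<open>b\<^sup>2 / 16\<close> is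
\<open>(min \<psi> / max \<psi>)\<^sup>2 L\<^sup>2\<close> with \<open>min \<psi> \<ge> 2/3\<close> and \<open>max \<psi> \<le> 16 (L/2) / (3 b)\<close>.\<close>

lemma gap_for_normalised_potential:
  assumes b: "0 < b" and L: "10 * b \<le> L"
    and ae: "AE x in lebesgue. v x = w x"
    and wm: "w \<in> borel_measurable lebesgue" and w: "\<And>t. 0 \<le> w t \<and> w t \<le> 1 / (2 * b\<^sup>2)"
    and even: "\<And>t. w (- t) = w t" and out: "\<And>t. b \<le> t \<Longrightarrow> w t = 0"
  shows "b\<^sup>2 / 16 / L ^ 4 \<le> spectral_gap v L"
proof -
  define R where "R = 1 / (2 * b\<^sup>2)"
  define l where "l = L / 2"
  have l: "L / 2 = l" "- L / 2 = - l" "0 < l" "b < l" "4 * b \<le> l - b" "L = 2 * l" using L b by (auto simp: l_def)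
  have L0: "0 < L" using l by simp
  have wR: "\<And>t. 0 \<le> w t \<and> w t \<le> R" using w by (simp add: R_def)
  then have bd: "\<And>t. \<bar>w t\<bar> \<le> R" by auto
  have small: "b\<^sup>2 * R \<le> 1/2" using b by (simp add: R_def)
  have K: "(pi / (2 * (l - b)))\<^sup>2 \<le> R"
  proof -
    have "pi / (2 * (l - b)) \<le> 4 / (2 * (4 * b))" using l b pi_less_4 by (intro frac_le) auto
    also have "\<dots> = 1 / (2 * b)" by simp
    finally have "(pi / (2 * (l - b)))\<^sup>2 \<le> (1 / (2 * b))\<^sup>2" using l by (intro power_mono) auto
    also have "\<dots> = 1 / (4 * b\<^sup>2)" by (simp add: power2_eq_square)
    also have "\<dots> \<le> R" unfolding R_def using b by (intro divide_left_mono) auto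
    finally show ?thesis .
  qed
  obtain E0 \<psi> \<psi>' where \<psi>: "ode_on (\<lambda>t. w t - E0) (- l) l \<psi> \<psi>'" "\<psi>' (- l) = 0" "\<psi>' l = 0"
    and \<psi>_all: "\<forall>t\<in>{- l..l}. 2/3 \<le> \<psi> t \<and> \<psi> t \<le> 16 * l / (3 * b)"
    by (rule positive_even_eigenfunction[OF b l(4) R_def K wm wR even out]) blast
  have \<psi>b: "2/3 \<le> \<psi> t \<and> \<psi> t \<le> 16 * l / (3 * b)" if "t \<in> {- l..l}" for t
    using \<psi>_all that by blast
  have \<psi>p: "0 < \<psi> t" if "t \<in> {- l..l}" for t using \<psi>b[OF that] by linarith
  have prop0: "\<exists>k. \<forall>x\<in>{- l..l}. \<eta> x = k * \<psi> x"
    if "ode_on (\<lambda>t. w t - E0) (- l) l \<eta> \<eta>'" "\<eta>' (- l) = 0" "\<eta>' l = 0" for \<eta> \<eta>'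
  proof (intro exI ballI)
    fix x assume x: "x \<in> {- l..l}"
    show "\<eta> x = \<eta> l / \<psi> l * \<psi> x"
      by (rule same_energy_proportional[OF _ bd \<psi>(1) that(1) _ \<psi>p x])
        (use l(3) \<psi>(3) that(3) in simp_all)
  qed
  obtain E1 g g' where g: "ode_on (\<lambda>t. w t - E1) 0 l g g'" "g 0 = 0" "g' 0 = 1" "g' l = 0"
    and g_all: "\<forall>t\<in>{0<..l}. 0 < g t"
    by (rule odd_eigenfunction[OF b l(4) small K wm wR even out]) blast
  have gpos: "0 < g t" if "t \<in> {0<..l}" for t using g_all that by blast
  define \<phi> where "\<phi> = (\<lambda>x. if x \<le> 0 then - g (- x) else g x)"
  have ev: "w (- t) - E1 = w t - E1" for t by (simp add: even)
  have \<phi>: "ode_on (\<lambda>t. w t - E1) (- l) l \<phi> (\<lambda>x. g' \<bar>x\<bar>)"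
    unfolding \<phi>_def by (rule odd_extension[OF _ g(1) ev g(2)]) (use l in simp)
  have \<phi>l: "\<phi> l \<noteq> 0" using gpos[of l] l by (simp add: \<phi>_def)
  have m0: "multiplicity_of v L E0 = 1"
    by (rule multiplicity_one_if_proportional[OF ae wm bd L0, where f = \<psi> and f' = \<psi>' and y = l])
      (use \<psi> l \<psi>p[of l] prop0 in auto)
  have m1: "multiplicity_of v L E1 = 1"
  proof (rule multiplicity_one_if_proportional[OF ae wm bd L0, where f = \<phi> and f' = "\<lambda>x. g' \<bar>x\<bar>" and y = l])
    show "\<exists>k. \<forall>x\<in>{- L / 2..L / 2}. \<eta> x = k * \<phi> x"
      if "ode_on (\<lambda>t. w t - E1) (- L / 2) (L / 2) \<eta> \<eta>'" "\<eta>' (- L / 2) = 0" "\<eta>' (L / 2) = 0" for \<eta> \<eta>'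
      using proportional_to_odd[OF l(3) bd even g gpos, of \<eta> \<eta>'] that unfolding l(1,2) \<phi>_def by simp
  qed (use \<phi> \<phi>l g l in \<open>auto simp: l(1,2)\<close>)
  have "E1 \<noteq> E0"
  proof
    assume "E1 = E0"
    then obtain k where k: "\<forall>x\<in>{- l..l}. \<phi> x = k * \<psi> x" using prop0[of \<phi> "\<lambda>x. g' \<bar>x\<bar>"] \<phi> g l by auto
    have "\<phi> 0 = 0" using g by (simp add: \<phi>_def)
    then have "k = 0" using k \<psi>p[of 0] l by force
    then show False using k \<phi>l l by simp
  qed
  have sep: "E0 + b\<^sup>2 / 16 / L ^ 4 \<le> E" if E: "E \<noteq> E0" "multiplicity_of v L E \<noteq> 0" for E
  proof -
    obtain f x where f: "f \<in> eigenspace v L E" "f x \<noteq> 0" using E(2) multiplicity_eq_zero by metis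
    obtain f' where f':
      "ode_on (\<lambda>t. w t - E) (- l) l (\<lambda>x. Re (f x)) (\<lambda>x. Re (f' x))"
      "ode_on (\<lambda>t. w t - E) (- l) l (\<lambda>x. Im (f x)) (\<lambda>x. Im (f' x))"
      "f' (- l) = 0" "f' l = 0" "\<And>x. x \<notin> {- l..l} \<Longrightarrow> f x = 0"
      using eigenspace_real_parts[OF ae f(1)] unfolding l(1,2) by metis
    have x: "x \<in> {- l..l}" using f(2) f'(5) by blast
    have main: "E0 + b\<^sup>2 / 16 / L ^ 4 \<le> E"
      if \<eta>: "ode_on (\<lambda>t. w t - E) (- l) l \<eta> \<eta>'" "\<eta>' (- l) = 0" "\<eta>' l = 0" and nz: "\<eta> x \<noteq> 0" for \<eta> \<eta>'
    proof -
      have ll: "- l < l" using l by simp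
      have "\<not> E < E0"
        using no_eigenvalue_below[OF ll bd \<psi>(1) \<eta>(1) \<psi>(2,3) \<eta>(2,3) \<psi>p _ x] nz by blast
      moreover have "((2/3) / (16 * l / (3 * b)))\<^sup>2 / (l - - l)\<^sup>2 \<le> \<bar>E - E0\<bar>"
        by (rule distance_to_other_eigenvalues[OF ll bd \<psi>(1) \<eta>(1) \<psi>(2,3) \<eta>(2,3) _ \<psi>b E(1) x nz]) simp_all
      moreover have "((2/3) / (16 * l / (3 * b)))\<^sup>2 / (l - - l)\<^sup>2 = b\<^sup>2 / 16 / L ^ 4"
        using b l(3) by (simp add: l(6) power2_eq_square power4_eq_xxxx field_simps)
      ultimately show ?thesis by linarith
    qed
    have "Re (f x) \<noteq> 0 \<or> Im (f x) \<noteq> 0" using f(2) by (auto simp: complex_eq_iff)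
    then show ?thesis using main[OF f'(1)] main[OF f'(2)] f'(3,4) by auto
  qed
  show ?thesis
    by (rule spectral_gap_ge[OF m0 \<open>E1 \<noteq> E0\<close> _ _ sep]) (use m1 in auto)
qed

text \<open>The complement of the essential support is a union of open sets on each of which \<open>v\<close>
vanishes almost everywhere; by Lindelof, countably many of them suffice.\<close>

lemma vanishes_off_ess_support: "AE x in lebesgue. x \<notin> ess_support v \<longrightarrow> v x = 0"
proof -
  define \<U> where "\<U> = {U. open U \<and> (AE y in lebesgue. y \<in> U \<longrightarrow> v y = 0)}"
  obtain \<V> where \<V>: "\<V> \<subseteq> \<U>" "countable \<V>" "\<Union>\<V> = \<Union>\<U>"
    using Lindelof[of \<U>] unfolding \<U>_def by blast
  have "AE x in lebesgue. \<forall>U\<in>\<V>. x \<in> U \<longrightarrow> v x = 0"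
    using \<V> by (subst AE_ball_countable) (auto simp: \<U>_def)
  then show ?thesis
  proof eventually_elim
    case (elim x)
    have "x \<in> \<Union>\<V>" if "x \<notin> ess_support v" using that unfolding \<V>(3) ess_support_def \<U>_def by blast
    then show ?case using elim by blast
  qed
qed

text \<open>Setting \<open>w\<close> to zero at \<open>\<plusminus> b\<close> as well makes the equation exactly \<open>f'' = - E f\<close> on \<open>[b, L/2]\<close>.
The bound \<open>1 / (2 b\<^sup>2)\<close> is what \<open>b\<^sup>2 \<parallel>v\<parallel> < 1/2\<close> says about \<open>v\<close> almost everywhere.\<close>

lemma normalised_representative:
  assumes v: "v \<in> Linf" and nonneg: "\<forall>x. v x \<ge> 0" and even: "\<forall>x. v x = v (- x)"
    and b: "0 < b" and supp: "ess_support v = {-b..b}"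
    and bound: "ereal (b\<^sup>2) * Linf_norm v < ereal (1/2)"
  obtains w where "AE x in lebesgue. v x = w x" "w \<in> borel_measurable lebesgue"
    "\<And>t. 0 \<le> w t \<and> w t \<le> 1 / (2 * b\<^sup>2)" "\<And>t. w (- t) = w t" "\<And>t. b \<le> t \<Longrightarrow> w t = 0"
proof -
  define R where "R = 1 / (2 * b\<^sup>2)"
  define w where "w = (\<lambda>t. if t \<in> {-b<..<b} then min (v t) R else 0)"
  have vm: "v \<in> borel_measurable lebesgue" using v by (simp add: Linf_def)
  have LR: "Linf_norm v \<le> ereal R"
    using bound b v by (cases "Linf_norm v") (auto simp: R_def field_simps Linf_def)
  have "AE x in lebesgue. ereal \<bar>v x\<bar> \<le> Linf_norm v"
    unfolding Linf_norm_def by (rule esssup_AE)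
  then have vR: "AE x in lebesgue. v x \<le> R"
  proof eventually_elim
    case (elim x)
    then have "ereal \<bar>v x\<bar> \<le> ereal R" using LR by (rule order_trans)
    then show ?case by simp
  qed
  have pts: "AE x in lebesgue. x \<notin> {-b, b}"
    by (rule AE_not_in) (simp add: negligible_iff_null_sets[symmetric] negligible_finite)
  have "AE x in lebesgue. v x = w x"
    using vR pts vanishes_off_ess_support[of v]
  proof eventually_elim
    case (elim x)
    then show ?case unfolding w_def supp by auto
  qed
  moreover have "w \<in> borel_measurable lebesgue"
    unfolding w_def using vm by (intro measurable_If_set borel_measurable_min) auto
  moreover have "0 \<le> w t \<and> w t \<le> 1 / (2 * b\<^sup>2)" for t
    using nonneg by (simp add: w_def R_def)
  moreover have "w (- t) = w t" for t using even by (auto simp: w_def)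
  moreover have "w t = 0" if "b \<le> t" for t using that by (simp add: w_def)
  ultimately show thesis by (rule that)
qed

theorem theorem2p3:
  fixes v :: "real \<Rightarrow> real" and b \<epsilon> \<gamma> :: real
  assumes "v \<in> Linf" and "integrable lebesgue v"
    and "\<forall>x. v x \<ge> 0"
    and "\<forall>x. v x = v (- x)"
    and "0 < b" and "ess_support v = {-b..b}"
    and "0 < \<epsilon>" and "\<epsilon> \<le> b"
    and "strict_mono_on {-b..-\<epsilon>} v"
    and "\<gamma> > 0" and "(INF x\<in>{-\<epsilon>..0}. v x) > \<gamma>"
    and "ereal (b\<^sup>2) * Linf_norm v < ereal (1/2)"
  shows "\<exists>\<beta>>0. \<exists>L0>0. \<forall>L\<ge>L0. spectral_gap v L \<ge> \<beta> / L ^ 4"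
proof -
  obtain w where w: "AE x in lebesgue. v x = w x" "w \<in> borel_measurable lebesgue"
    "\<And>t. 0 \<le> w t \<and> w t \<le> 1 / (2 * b\<^sup>2)" "\<And>t. w (- t) = w t" "\<And>t. b \<le> t \<Longrightarrow> w t = 0"
    by (rule normalised_representative[OF assms(1,3,4,5,6,12)]) blast
  have "b\<^sup>2 / 16 / L ^ 4 \<le> spectral_gap v L" if "10 * b \<le> L" for L
    by (rule gap_for_normalised_potential[OF \<open>0 < b\<close> that w])
  then show ?thesis
    using \<open>0 < b\<close> by (intro exI[of _ "b\<^sup>2 / 16"] conjI exI[of _ "10 * b"]) auto
qed

end
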